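(* Let $n\ge5$. The symmetric group orbit of the maximal prime cone $C_{\rm FFLV}\subset\mathrm{Trop}(\mathcal F\ell_n)=\mathrm{Trop}(J_n)$ does not meet the totally positive part $\mathrm{Trop}^+(\mathcal F\ell_n)=\mathrm{Trop}^+(J_n)$, in the sense that no relative interior point of a cone $\sigma(C_{\rm FFLV})$, $\sigma\in S_n$, lies in $\mathrm{Trop}^+(J_n)$. Equivalently, there is no $\sigma\in S_n$ such that the ideal $\sigma(I_{\rm FFLV})$ is totally positive.
   Context: $\mathcal F\ell_n$ is the variety of full flags in $\mathbb R^n$ and $J_n\subset\mathbb R[p_J:\varnothing\ne J\subsetneq[n]]$ its multihomogeneous Plücker ideal (the relations among the flag minors: $p_J$ is the minor of an $n\times n$ matrix on rows $J$ and the first $|J|$ columns). $S_n$ acts on the polynomial ring by $\sigma(p_{\{j_1<\dots<j_k\}})=(-1)^{\ell}p_{\{\sigma(j_1),\dots,\sigma(j_k)\}}$, where $\ell$ is the number of transpositions needed to sort $\sigma(j_1),\dots,\sigma(j_k)$ increasingly; $J_n$ is invariant, so $S_n$ acts on $\mathrm{Trop}(J_n)$ by permuting coordinates, compatibly with the action on initial ideals. $\mathrm{Trop}(J)$ is the set of weight vectors $w$ for which $\mathrm{in}_w(J)$ contains no monomial, with the fan structure from the Gröbner fan ($v,w$ lie in the relative interior of the same cone $\tau$ iff $\mathrm{in}_v(J)=\mathrm{in}_w(J)=:\mathrm{in}_\tau(J)$). A maximal cone is prime if its initial ideal is binomial and prime. An ideal in a real polynomial ring is totally positive if it contains no nonzero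 polynomial with all coefficients $\geq 0$. $\mathrm{Trop}^+(J)=\{w\in\mathrm{Trop}(J):\mathrm{in}_w(J)\text{ totally positive}\}$. **FFLV ideal.** Let $N=\binom n2$, and index coordinates of $\mathbb Z^N$ by pairs $1\le i<j\le n$ (positive roots $\epsilon_i-\epsilon_j$ of $\mathfrak{sl}_n$), ordered in a sequence such that $(i,j)$ precedes $(i',j')$ whenever $j-i>j'-i'$. Let $\prec$ be the homogeneous right lexicographic order on $\mathbb Z^N$: $a\prec b$ iff $\sum a_i<\sum b_i$, or the sums agree and the rightmost nonzero entry of $b-a$ is positive. Let $f_{i,j}\in\mathfrak n^-$ be the root operators ($f_{i,j}e_i=e_j$, $f_{i,j}e_l=0$ for $l\ne i$) acting on $\bigwedge^\ell\mathbb R^n$. For $J=\{j_1<\dots<j_\ell\}$, $m_J\in\mathbb Z^N_{\ge0}$ is the $\prec$-minimal $a$ such that the ordered monomial $f_{i_1,j_1}^{a_1}\cdots f_{i_N,j_N}^{a_N}$ maps $e_1\wedge\dots\wedge e_\ell$ to a nonzero multiple of $e_{j_1}\wedge\dots\wedge e_{j_\ell}$. Let $M$ be the matrix with columns $m_J$. For $f=\sum c_ax^a$ (in the Plücker variables), $\mathrm{in}_M(f)$ is the sum of its terms with $Ma$ minimal for $\prec$, and $I_{\rm FFLV}:=\mathrm{in}_M(J_n)=(\mathrm{in}_M(f):f\in J_n)$. It is the initial ideal of a unique maximal prime cone of $\mathrm{Trop}(J_n)$, called $C_{\rm FFLV}$. *)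

theory Defs
  imports
    "HOL-Library.Poly_Mapping"
    "HOL-Combinatorics.Permutations"
    "HOL-Algebra.Ideal"
    "Jordan_Normal_Form.Determinant"
begin

section \<open>Real polynomials\<close>

text \<open>
  A monomial is a finitely supported exponent vector and a polynomial is a finitely supported
  family of real coefficients indexed by monomials; multiplication is the convolution of
  \<^theory>\<open>HOL-Library.Poly_Mapping\<close>.
\<close>

type_synonym 'v real_mpoly = "('v \<Rightarrow>\<^sub>0 nat) \<Rightarrow>\<^sub>0 real"

definition indet :: "'v \<Rightarrow> 'v real_mpoly" where
  "indet v = Poly_Mapping.single (Poly_Mapping.single v 1) 1"

text \<open>The \<open>\<real>\<close>-algebra homomorphism sending the indeterminate \<open>v\<close> to \<open>\<phi> v\<close>.\<close>

definition poly_subst :: "('v \<Rightarrow> 'u real_mpoly) \<Rightarrow> 'v real_mpoly \<Rightarrow> 'u real_mpoly" where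
  "poly_subst \<phi> f =
    (\<Sum>a\<in>Poly_Mapping.keys f. Poly_Mapping.single 0 (Poly_Mapping.lookup f a) *
      (\<Prod>v\<in>Poly_Mapping.keys a. \<phi> v ^ Poly_Mapping.lookup a v))"

definition totally_positive :: "'v real_mpoly set \<Rightarrow> bool" where
  "totally_positive I \<longleftrightarrow> \<not> (\<exists>f\<in>I. f \<noteq> 0 \<and> (\<forall>a. 0 \<le> Poly_Mapping.lookup f a))"

text \<open>
  For a strict comparison \<open>lt\<close> of monomials, the sum of the terms of \<open>f\<close> whose monomial is
  minimal among those occurring in \<open>f\<close>.
\<close>

definition initial_form ::
    "(('v \<Rightarrow>\<^sub>0 nat) \<Rightarrow> ('v \<Rightarrow>\<^sub>0 nat) \<Rightarrow> bool) \<Rightarrow> 'v real_mpoly \<Rightarrow> 'v real_mpoly" where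
  "initial_form lt f =
    (\<Sum>a\<in>{a \<in> Poly_Mapping.keys f. \<forall>b\<in>Poly_Mapping.keys f. \<not> lt b a}.
      Poly_Mapping.single a (Poly_Mapping.lookup f a))"


section \<open>The Pluecker ideal of the full flag variety\<close>

definition plucker_index :: "nat \<Rightarrow> nat set set" where
  "plucker_index n = {J. J \<noteq> {} \<and> J \<subset> {1..n}}"

definition plucker_ring :: "nat \<Rightarrow> nat set real_mpoly ring" where
  "plucker_ring n =
    \<lparr>carrier = {f. \<forall>a\<in>Poly_Mapping.keys f. Poly_Mapping.keys a \<subseteq> plucker_index n},
     monoid.mult = (*), one = 1, zero = 0, add = (+)\<rparr>"

text \<open>
  The minor of the generic matrix \<open>(x\<^bsub>r,c\<^esub>)\<close> on the rows \<open>J\<close> and the columns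
  \<open>1, \<dots>, |J|\<close>; the entries of \<^const>\<open>mat\<close> are numbered from \<open>0\<close>.
\<close>

definition flag_minor :: "nat set \<Rightarrow> (nat \<times> nat) real_mpoly" where
  "flag_minor J =
    det (mat (card J) (card J) (\<lambda>(s, t). indet (sorted_list_of_set J ! s, Suc t)))"

definition plucker_ideal :: "nat \<Rightarrow> nat set real_mpoly set" where
  "plucker_ideal n = {f \<in> carrier (plucker_ring n). poly_subst flag_minor f = 0}"

definition initial_ideal ::
    "nat \<Rightarrow> ((nat set \<Rightarrow>\<^sub>0 nat) \<Rightarrow> (nat set \<Rightarrow>\<^sub>0 nat) \<Rightarrow> bool)
      \<Rightarrow> nat set real_mpoly set \<Rightarrow> nat set real_mpoly set" where
  "initial_ideal n lt I = genideal (plucker_ring n) (initial_form lt ` I)"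


section \<open>Tropicalization and its totally positive part\<close>

text \<open>
  Weight vectors live in \<open>\<real>\<^bsup>V\<^esup>\<close> with \<open>V = plucker_index n\<close>, realised as the functions
  vanishing outside \<open>V\<close>.
\<close>

definition weights :: "nat \<Rightarrow> (nat set \<Rightarrow> real) set" where
  "weights n = {w. \<forall>J. J \<notin> plucker_index n \<longrightarrow> w J = 0}"

definition weight_of :: "(nat set \<Rightarrow> real) \<Rightarrow> (nat set \<Rightarrow>\<^sub>0 nat) \<Rightarrow> real" where
  "weight_of w a = (\<Sum>J\<in>Poly_Mapping.keys a. w J * real (Poly_Mapping.lookup a J))"

definition in_weight ::
    "nat \<Rightarrow> (nat set \<Rightarrow> real) \<Rightarrow> nat set real_mpoly set \<Rightarrow> nat set real_mpoly set" where
  "in_weight n w I = initial_ideal n (\<lambda>a b. weight_of w a < weight_of w b) I"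

definition Trop :: "nat \<Rightarrow> nat set real_mpoly set \<Rightarrow> (nat set \<Rightarrow> real) set" where
  "Trop n I = {w \<in> weights n. \<not> (\<exists>a. Poly_Mapping.single a 1 \<in> in_weight n w I)}"

definition Trop_pos :: "nat \<Rightarrow> nat set real_mpoly set \<Rightarrow> (nat set \<Rightarrow> real) set" where
  "Trop_pos n I = {w \<in> Trop n I. totally_positive (in_weight n w I)}"

text \<open>
  In the Groebner fan of \<open>I\<close> two weight vectors lie in the relative interior of the same cone
  iff they have the same initial ideal.  So the cone \<open>\<tau>\<close> with initial ideal \<open>in\<^sub>\<tau>(I) = I'\<close> is the
  closure of the following set, which is its relative interior.
\<close>

definition cone_rel_interior ::
    "nat \<Rightarrow> nat set real_mpoly set \<Rightarrow> nat set real_mpoly set \<Rightarrow> (nat set \<Rightarrow> real) set" where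
  "cone_rel_interior n I I' = {w \<in> weights n. in_weight n w I = I'}"


section \<open>The action of the symmetric group\<close>

text \<open>
  The number of adjacent transpositions needed to sort a list of distinct numbers.
\<close>

definition inversions :: "nat list \<Rightarrow> nat" where
  "inversions ks = card {(s, t). s < t \<and> t < length ks \<and> ks ! t < ks ! s}"

definition perm_poly :: "(nat \<Rightarrow> nat) \<Rightarrow> nat set real_mpoly \<Rightarrow> nat set real_mpoly" where
  "perm_poly \<sigma> =
    poly_subst (\<lambda>J. (- 1) ^ inversions (map \<sigma> (sorted_list_of_set J)) * indet (\<sigma> ` J))"

text \<open>Permutation of coordinates: the \<open>\<sigma>(J)\<close>-th coordinate of \<open>\<sigma>(w)\<close> is the \<open>J\<close>-th of \<open>w\<close>.\<close>

definition perm_weight :: "(nat \<Rightarrow> nat) \<Rightarrow> (nat set \<Rightarrow> real) \<Rightarrow> nat set \<Rightarrow> real" where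
  "perm_weight \<sigma> w = (\<lambda>J. w (inv_into UNIV \<sigma> ` J))"


section \<open>The FFLV ideal\<close>

text \<open>
  The sequences of all pairs \<open>1 \<le> i < j \<le> n\<close> (the root \<open>\<epsilon>\<^sub>i - \<epsilon>\<^sub>j\<close>) in which pairs with larger
  \<open>j - i\<close> come first; the order among pairs with equal \<open>j - i\<close> is arbitrary.
\<close>

definition good_root_sequence :: "nat \<Rightarrow> (nat \<times> nat) list \<Rightarrow> bool" where
  "good_root_sequence n rs \<longleftrightarrow>
    distinct rs \<and> set rs = {(i, j). 1 \<le> i \<and> i < j \<and> j \<le> n} \<and>
    (\<forall>k < length rs. \<forall>l < length rs.
      snd (rs ! k) - fst (rs ! k) > snd (rs ! l) - fst (rs ! l) \<longrightarrow> k < l)"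

text \<open>
  The homogeneous right lexicographic order.  It is only ever applied to vectors with
  nonnegative entries; \<open>a (rs ! k) < b (rs ! k)\<close> says that this entry of \<open>b - a\<close> is positive.
\<close>

definition hom_right_lex ::
    "(nat \<times> nat) list \<Rightarrow> (nat \<times> nat \<Rightarrow> nat) \<Rightarrow> (nat \<times> nat \<Rightarrow> nat) \<Rightarrow> bool" where
  "hom_right_lex rs a b \<longleftrightarrow>
    (\<Sum>r\<in>set rs. a r) < (\<Sum>r\<in>set rs. b r) \<or>
    (\<Sum>r\<in>set rs. a r) = (\<Sum>r\<in>set rs. b r) \<and>
    (\<exists>k < length rs. a (rs ! k) < b (rs ! k) \<and>
      (\<forall>l. k < l \<and> l < length rs \<longrightarrow> a (rs ! l) = b (rs ! l)))"

text \<open>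
  An element of the exterior algebra of \<open>\<real>\<^bsup>n\<^esup>\<close> is given by its coordinates in the basis
  \<open>e\<^sub>K = e\<^bsub>k\<^sub>1\<^esub> \<and> \<dots> \<and> e\<^bsub>k\<^sub>l\<^esub>\<close> for \<open>K = {k\<^sub>1 < \<dots> < k\<^sub>l} \<subseteq> {1..n}\<close>; \<open>\<And>\<^bsup>l\<^esup> \<real>\<^bsup>n\<^esup>\<close> is the part supported on
  sets of size \<open>l\<close>.  The wedge product of the basis vectors listed in \<open>ks\<close>:
\<close>

definition wedge_list :: "nat list \<Rightarrow> nat set \<Rightarrow> real" where
  "wedge_list ks K =
    (if distinct ks \<and> K = set ks then (- 1) ^ inversions ks else 0)"

text \<open>
  The action of \<open>f\<^bsub>i,j\<^esub>\<close> as a derivation: on \<open>e\<^sub>L\<close> it is the sum, over the factors \<open>e\<^sub>i\<close>, of the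
  wedge products with that factor replaced by \<open>e\<^sub>j\<close>.
\<close>

definition root_op ::
    "nat \<Rightarrow> nat \<times> nat \<Rightarrow> (nat set \<Rightarrow> real) \<Rightarrow> nat set \<Rightarrow> real" where
  "root_op n r v K =
    (\<Sum>L\<in>Pow {1..n}. v L *
      (\<Sum>t\<in>{t. t < card L \<and> sorted_list_of_set L ! t = fst r}.
        wedge_list ((sorted_list_of_set L)[t := snd r]) K))"

text \<open>The leftmost factor of the ordered monomial is applied last.\<close>

definition ordered_monomial_op ::
    "nat \<Rightarrow> (nat \<times> nat) list \<Rightarrow> (nat \<times> nat \<Rightarrow> nat) \<Rightarrow> (nat set \<Rightarrow> real) \<Rightarrow> nat set \<Rightarrow> real" where
  "ordered_monomial_op n rs a v = foldr (\<lambda>r. root_op n r ^^ a r) rs v"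

definition fflv_exponents ::
    "nat \<Rightarrow> (nat \<times> nat) list \<Rightarrow> nat set \<Rightarrow> (nat \<times> nat \<Rightarrow> nat) set" where
  "fflv_exponents n rs J =
    {a. (\<forall>r. r \<notin> set rs \<longrightarrow> a r = 0) \<and>
        (\<exists>c. c \<noteq> 0 \<and> ordered_monomial_op n rs a (wedge_list [1..<Suc (card J)]) =
               (\<lambda>K. c * wedge_list (sorted_list_of_set J) K))}"

definition fflv_column ::
    "nat \<Rightarrow> (nat \<times> nat) list \<Rightarrow> nat set \<Rightarrow> nat \<times> nat \<Rightarrow> nat" where
  "fflv_column n rs J =
    (THE a. a \<in> fflv_exponents n rs J \<and>
       (\<forall>b\<in>fflv_exponents n rs J. b \<noteq> a \<longrightarrow> hom_right_lex rs a b))"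

text \<open>The vector \<open>M a\<close>, where \<open>M\<close> is the matrix with columns \<open>m\<^sub>J\<close>.\<close>

definition fflv_mult ::
    "nat \<Rightarrow> (nat \<times> nat) list \<Rightarrow> (nat set \<Rightarrow>\<^sub>0 nat) \<Rightarrow> nat \<times> nat \<Rightarrow> nat" where
  "fflv_mult n rs a r =
    (\<Sum>J\<in>Poly_Mapping.keys a. fflv_column n rs J r * Poly_Mapping.lookup a J)"

definition I_FFLV :: "nat \<Rightarrow> (nat \<times> nat) list \<Rightarrow> nat set real_mpoly set" where
  "I_FFLV n rs =
    initial_ideal n (\<lambda>a b. hom_right_lex rs (fflv_mult n rs a) (fflv_mult n rs b))
      (plucker_ideal n)"

text \<open>The relative interior of the cone \<open>C\<^bsub>FFLV\<^esub>\<close>, i.e. of the cone with initial ideal \<open>I\<^bsub>FFLV\<^esub>\<close>.\<close>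

definition C_FFLV_rel_interior :: "nat \<Rightarrow> (nat \<times> nat) list \<Rightarrow> (nat set \<Rightarrow> real) set" where
  "C_FFLV_rel_interior n rs = cone_rel_interior n (plucker_ideal n) (I_FFLV n rs)"

end

(*
  The Pluecker variables indexed by subsets of {1,..,5} already suffice.  For S = {}, {3}, {4},
  the three-term relation

    p_{S1} p_{S25} - p_{S2} p_{S15} + p_{S5} p_{S12} = 0

  (signs for sorted index sets) has as its FFLV initial form the binomial that omits the term
  singled out by 2, 1, 5, respectively.  Since sigma permutes the three terms of the relation
  accordingly, and the term of the median of sigma(1), sigma(2), sigma(5) is the one whose sign
  differs from the others, choosing S so that the omitted term becomes that of the median turns
  sigma of the binomial into one with both coefficients of the same sign.

  The initial forms are read off from an explicit description of the FFLV columns: m_J is the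
  indicator of the order-preserving matching from {1,..,l} - J to J - {1,..,l}, l = |J|.
  Counting weights shows that any exponent has degree at least that of a matching, and every
  matching that is not order-preserving has a larger exponent.

  The statement about cones follows since sigma maps the initial ideal of the Pluecker ideal with
  respect to w into the one with respect to sigma(w).
*)

theory Submission
  imports Defs "HOL-Algebra.QuotRing"
begin

section \<open>Substitution homomorphisms\<close>

abbreviation lookup :: "('a \<Rightarrow>\<^sub>0 'b::zero) \<Rightarrow> 'a \<Rightarrow> 'b" where
  "lookup \<equiv> Poly_Mapping.lookup"

abbreviation keys :: "('a \<Rightarrow>\<^sub>0 'b::zero) \<Rightarrow> 'a set" where
  "keys \<equiv> Poly_Mapping.keys"

abbreviation single :: "'a \<Rightarrow> 'b \<Rightarrow> 'a \<Rightarrow>\<^sub>0 'b::zero" where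
  "single \<equiv> Poly_Mapping.single"

definition monom_subst :: "('v \<Rightarrow> 'u real_mpoly) \<Rightarrow> ('v \<Rightarrow>\<^sub>0 nat) \<Rightarrow> 'u real_mpoly" where
  "monom_subst \<phi> a = (\<Prod>v\<in>keys a. \<phi> v ^ lookup a v)"

lemma poly_eq_sum_singles: "f = (\<Sum>a\<in>keys f. single a (lookup f a))"
  by (rule poly_mapping_eqI)
    (auto simp: lookup_sum lookup_single when_def in_keys_iff sum.delta if_distrib cong: if_cong)

lemma monom_subst_superset:
  assumes "finite V" "keys a \<subseteq> V"
  shows "monom_subst \<phi> a = (\<Prod>v\<in>V. \<phi> v ^ lookup a v)"
  unfolding monom_subst_def
  by (rule prod.mono_neutral_left) (use assms in \<open>auto simp: in_keys_iff\<close>)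

lemma monom_subst_add: "monom_subst \<phi> (a + b) = monom_subst \<phi> a * monom_subst \<phi> b"
proof -
  let ?V = "keys a \<union> keys b"
  have "monom_subst \<phi> (a + b) = (\<Prod>v\<in>?V. \<phi> v ^ lookup (a + b) v)"
    by (rule monom_subst_superset) (auto simp: Poly_Mapping.keys_add)
  also have "\<dots> = (\<Prod>v\<in>?V. \<phi> v ^ lookup a v) * (\<Prod>v\<in>?V. \<phi> v ^ lookup b v)"
    by (simp add: lookup_add power_add prod.distrib)
  also have "\<dots> = monom_subst \<phi> a * monom_subst \<phi> b"
    by (subst (1 2) monom_subst_superset[where V = ?V]) auto
  finally show ?thesis .
qed

lemma poly_subst_superset:
  assumes "finite S" "keys f \<subseteq> S"
  shows "poly_subst \<phi> f = (\<Sum>a\<in>S. single 0 (lookup f a) * monom_subst \<phi> a)"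
  unfolding poly_subst_def monom_subst_def
  by (rule sum.mono_neutral_left) (use assms in \<open>auto simp: in_keys_iff\<close>)

lemma poly_subst_zero [simp]: "poly_subst \<phi> 0 = 0"
  by (simp add: poly_subst_def)

lemma poly_subst_add: "poly_subst \<phi> (f + g) = poly_subst \<phi> f + poly_subst \<phi> g"
proof -
  let ?S = "keys f \<union> keys g"
  have "poly_subst \<phi> (f + g) = (\<Sum>a\<in>?S. single 0 (lookup (f + g) a) * monom_subst \<phi> a)"
    by (rule poly_subst_superset) (auto simp: Poly_Mapping.keys_add)
  also have "\<dots> = (\<Sum>a\<in>?S. single 0 (lookup f a) * monom_subst \<phi> a)
      + (\<Sum>a\<in>?S. single 0 (lookup g a) * monom_subst \<phi> a)"
    by (simp add: lookup_add single_add distrib_right sum.distrib)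
  also have "\<dots> = poly_subst \<phi> f + poly_subst \<phi> g"
    by (subst (1 2) poly_subst_superset[where S = ?S]) auto
  finally show ?thesis .
qed

lemma poly_subst_sum: "poly_subst \<phi> (sum F S) = (\<Sum>x\<in>S. poly_subst \<phi> (F x))"
  by (induction S rule: infinite_finite_induct) (simp_all add: poly_subst_add)

lemma poly_subst_single: "poly_subst \<phi> (single a c) = single 0 c * monom_subst \<phi> a"
  by (subst poly_subst_superset[where S = "{a}"]) auto

lemma poly_subst_indet [simp]: "poly_subst \<phi> (indet v) = \<phi> v"
  by (simp add: indet_def poly_subst_single monom_subst_def)

lemma poly_subst_mult:
  fixes \<phi> :: "'v \<Rightarrow> 'u real_mpoly"
  shows "poly_subst \<phi> (f * g) = poly_subst \<phi> f * poly_subst \<phi> g"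
proof -
  have "f * g = (\<Sum>a\<in>keys f. \<Sum>b\<in>keys g. single (a + b) (lookup f a * lookup g b))"
    by (subst poly_eq_sum_singles[of f], subst poly_eq_sum_singles[of g])
      (simp add: sum_product mult_single)
  moreover have "single 0 (lookup f a * lookup g b) =
      (single 0 (lookup f a) * single 0 (lookup g b) :: 'u real_mpoly)" for a b
    by (simp add: mult_single)
  ultimately have "poly_subst \<phi> (f * g) = (\<Sum>a\<in>keys f. \<Sum>b\<in>keys g.
      (single 0 (lookup f a) * monom_subst \<phi> a) * (single 0 (lookup g b) * monom_subst \<phi> b))"
    by (simp add: poly_subst_sum poly_subst_single monom_subst_add mult_ac)
  also have "\<dots> = poly_subst \<phi> f * poly_subst \<phi> g"
    by (simp add: poly_subst_superset[of "keys f" f] poly_subst_superset[of "keys g" g]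
        sum_product)
  finally show ?thesis .
qed

lemma poly_subst_const [simp]: "poly_subst \<phi> (single 0 c) = single 0 c"
  by (simp add: poly_subst_single monom_subst_def)

lemma poly_subst_one [simp]: "poly_subst \<phi> 1 = 1"
  using poly_subst_const[of \<phi> 1] by simp

text \<open>Lets substitution be moved through products, powers and, for flag minors,
  determinants.\<close>

interpretation poly_subst: comm_ring_hom "poly_subst \<phi>"
  by unfold_locales (simp_all add: poly_subst_add poly_subst_mult)

lemma poly_subst_poly_subst:
  "poly_subst \<psi> (poly_subst \<phi> f) = poly_subst (\<lambda>v. poly_subst \<psi> (\<phi> v)) f"
  by (simp add: poly_subst_def[of \<phi>] poly_subst_def[of "\<lambda>v. poly_subst \<psi> (\<phi> v)"]
      poly_subst_sum poly_subst_mult poly_subst.hom_prod poly_subst.hom_power)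

lemma poly_subst_cong:
  assumes "\<And>a v. a \<in> keys f \<Longrightarrow> v \<in> keys a \<Longrightarrow> \<phi> v = \<psi> v"
  shows "poly_subst \<phi> f = poly_subst \<psi> f"
  using assms by (simp add: poly_subst_def)


section \<open>Sorting rows of a determinant\<close>

text \<open>An inversion either starts at position 0 or is an inversion of the tail, shifted by one.
  This recursion serves both the inductions and the evaluation of signs of explicit lists.\<close>

lemma inversions_Cons: "inversions (x # xs) = length (filter (\<lambda>y. y < x) xs) + inversions xs"
proof -
  let ?I = "\<lambda>ks. {(s, t). s < t \<and> t < length ks \<and> ks ! t < ks ! s}"
  let ?A = "(\<lambda>t. (0 :: nat, Suc t)) ` {t. t < length xs \<and> xs ! t < x}"
  let ?B = "(\<lambda>(s, t). (Suc s, Suc t)) ` ?I xs"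
  have fin: "finite (?I xs)"
    by (rule finite_subset[of _ "{..<length xs} \<times> {..<length xs}"]) auto
  have "?I (x # xs) = ?A \<union> ?B"
  proof (rule Set.set_eqI)
    fix p :: "nat \<times> nat"
    obtain s t where p: "p = (s, t)" by fastforce
    show "p \<in> ?I (x # xs) \<longleftrightarrow> p \<in> ?A \<union> ?B"
      unfolding p by (cases s; cases t) (auto simp: image_iff)
  qed
  moreover have "card (?A \<union> ?B) = card ?A + card ?B"
    by (rule card_Un_disjoint) (use fin in auto)
  moreover have "card ?A = length (filter (\<lambda>y. y < x) xs)"
    by (subst card_image) (auto simp: inj_on_def length_filter_conv_card)
  moreover have "card ?B = card (?I xs)"
    by (rule card_image) (auto simp: inj_on_def)
  ultimately show ?thesis by (simp add: inversions_def)
qed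

lemma inversions_Nil [simp]: "inversions [] = 0"
  by (simp add: inversions_def)

lemma inversions_sorted: "sorted ks \<Longrightarrow> inversions ks = 0"
  by (induction ks) (auto simp: inversions_Cons filter_empty_conv)

text \<open>Entries of \<open>us\<close> see the same multiset to their right before and after the
  swap, so only the pair \<open>a\<close>, \<open>b\<close> itself changes status.\<close>

lemma inversions_swap_descent:
  "b < a \<Longrightarrow> inversions (us @ a # b # vs) = Suc (inversions (us @ b # a # vs))"
  by (induction us) (auto simp: inversions_Cons)

text \<open>Row labels form a list, not a set, so that rows can be out of order and reordering them
  is an operation on lists.\<close>

definition rows_det :: "('a \<Rightarrow> nat \<Rightarrow> 'b::comm_ring_1) \<Rightarrow> 'a list \<Rightarrow> 'b" where
  "rows_det F ks = det (mat (length ks) (length ks) (\<lambda>(s, t). F (ks ! s) t))"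

lemma rows_det_swap:
  "rows_det F (us @ a # b # vs) = - rows_det F (us @ b # a # vs)"
proof -
  let ?ks = "us @ a # b # vs" and ?ks' = "us @ b # a # vs"
  let ?m = "length ?ks"
  let ?A = "mat ?m ?m (\<lambda>(s, t). F (?ks' ! s) t)"
  have "mat ?m ?m (\<lambda>(s, t). F (?ks ! s) t) = swaprows (length us) (Suc (length us)) ?A"
    by (rule eq_matI) (auto simp: nth_append nth_Cons split: nat.splits)
  moreover have "det (swaprows (length us) (Suc (length us)) ?A) = - det ?A"
    by (rule det_swaprows[where n = ?m]) auto
  ultimately show ?thesis by (simp add: rows_det_def)
qed

text \<open>Bubble sort: swapping an adjacent descent removes one inversion and negates the
  determinant.\<close>

lemma rows_det_sort:
  "rows_det F ks = (- 1) ^ inversions ks * rows_det F (sort ks)"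
proof (induction "inversions ks" arbitrary: ks rule: less_induct)
  case less
  show ?case
  proof (cases "sorted ks")
    case True
    then show ?thesis by (simp add: inversions_sorted sorted_sort_id)
  next
    case False
    then obtain i where i: "Suc i < length ks" "ks ! Suc i < ks ! i"
      by (auto simp: sorted_iff_nth_Suc not_le)
    define us vs a b where "us = take i ks" and "vs = drop (Suc (Suc i)) ks"
      and "a = ks ! i" and "b = ks ! Suc i"
    have ks: "ks = us @ a # b # vs"
      using i by (simp add: us_def vs_def a_def b_def Cons_nth_drop_Suc)
    have inv: "inversions ks = Suc (inversions (us @ b # a # vs))"
      unfolding ks using i by (intro inversions_swap_descent) (simp add: a_def b_def)
    have "sort (us @ b # a # vs) = sort ks"
      unfolding ks by (rule properties_for_sort) (simp_all add: ac_simps)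
    then show ?thesis
      using less[of "us @ b # a # vs"] inv rows_det_swap[of F us a b vs] by (simp add: ks[symmetric])
  qed
qed

lemma flag_minor_eq_rows_det:
  "flag_minor J = rows_det (\<lambda>r t. indet (r, Suc t)) (sorted_list_of_set J)"
  by (simp add: flag_minor_def rows_det_def)

text \<open>Renaming commutes with the determinant and leaves the rows in the order in which
  \<sigma> lists them; sorting them costs exactly the sign built into
  \<open>perm_poly\<close>.\<close>

lemma poly_subst_rename_flag_minor:
  assumes "inj \<sigma>" "finite J"
  shows "poly_subst (\<lambda>(r, c). indet (\<sigma> r, c)) (flag_minor J) =
    (- 1) ^ inversions (map \<sigma> (sorted_list_of_set J)) * flag_minor (\<sigma> ` J)"
proof -
  let ?ks = "sorted_list_of_set J"
  have "poly_subst (\<lambda>(r, c). indet (\<sigma> r, c)) (flag_minor J) =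
      rows_det (\<lambda>r t. indet (r, Suc t)) (map \<sigma> ?ks)"
    unfolding flag_minor_eq_rows_det rows_det_def poly_subst.hom_det[symmetric]
    by (rule arg_cong[of _ _ det], rule eq_matI) auto
  also have "sort (map \<sigma> ?ks) = sorted_list_of_set (\<sigma> ` J)"
    using assms
    by (intro sorted_distinct_set_unique) (auto simp: distinct_map inj_on_def inj_def)
  hence "rows_det (\<lambda>r t. indet (r, Suc t)) (map \<sigma> ?ks) =
      (- 1) ^ inversions (map \<sigma> ?ks) * flag_minor (\<sigma> ` J)"
    by (subst rows_det_sort) (simp add: flag_minor_eq_rows_det)
  finally show ?thesis .
qed

section \<open>The action of the symmetric group\<close>

definition rename_monom :: "('v \<Rightarrow> 'u) \<Rightarrow> ('v \<Rightarrow>\<^sub>0 nat) \<Rightarrow> ('u \<Rightarrow>\<^sub>0 nat)" where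
  "rename_monom h a = (\<Sum>v\<in>keys a. single (h v) (lookup a v))"

lemma lookup_rename_monom:
  assumes "inj h"
  shows "lookup (rename_monom h a) (h v) = lookup a v"
proof -
  have "lookup (rename_monom h a) (h v) = (\<Sum>u\<in>keys a. lookup a u when u = v)"
    using assms by (simp add: rename_monom_def lookup_sum lookup_single inj_eq)
  also have "\<dots> = lookup a v"
    by (auto simp: when_def in_keys_iff)
  finally show ?thesis .
qed

lemma keys_rename_monom:
  assumes "inj h"
  shows "keys (rename_monom h a) = h ` keys a"
proof
  show "keys (rename_monom h a) \<subseteq> h ` keys a"
    unfolding rename_monom_def using Poly_Mapping.keys_sum by (fastforce split: if_splits)
  show "h ` keys a \<subseteq> keys (rename_monom h a)"
    by (auto simp: in_keys_iff lookup_rename_monom[OF assms])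
qed

lemma inj_rename_monom:
  assumes "inj h"
  shows "inj (rename_monom h)"
proof (rule injI, rule poly_mapping_eqI)
  fix a b v
  assume "rename_monom h a = rename_monom h b"
  then show "lookup a v = lookup b v"
    using lookup_rename_monom[OF assms] by metis
qed

lemma single_power_nat: "(single (single v 1) c) ^ k = (single (single v k) (c ^ k) :: 'v real_mpoly)"
  by (induction k) (simp_all add: mult_single single_add[symmetric])

lemma prod_single:
  "(\<Prod>x\<in>S. single (F x) (c x)) = (single (\<Sum>x\<in>S. F x) (\<Prod>x\<in>S. c x) :: 'v real_mpoly)"
  by (induction S rule: infinite_finite_induct) (simp_all add: mult_single)

definition perm_sign :: "(nat \<Rightarrow> nat) \<Rightarrow> (nat set \<Rightarrow>\<^sub>0 nat) \<Rightarrow> real" where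
  "perm_sign \<sigma> a =
    (\<Prod>J\<in>keys a. ((- 1) ^ inversions (map \<sigma> (sorted_list_of_set J))) ^ lookup a J)"

lemma perm_sign_nonzero [simp]: "perm_sign \<sigma> a \<noteq> 0"
  by (simp add: perm_sign_def)

lemma minus_one_power_single: "(- 1) ^ k = (single 0 ((- 1) ^ k) :: 'v real_mpoly)"
  by (induction k) (simp_all add: single_uminus)

text \<open>Each variable goes to plus or minus a variable, hence a monomial to a single monomial up
  to sign; support and coefficients of \<open>perm_poly \<sigma> f\<close> can then be read
  off.\<close>

lemma perm_poly_single:
  "perm_poly \<sigma> (single a c) = single (rename_monom ((`) \<sigma>) a) (perm_sign \<sigma> a * c)"
  by (simp add: perm_poly_def poly_subst_single monom_subst_def minus_one_power_single
      indet_def mult_single single_power_nat[simplified] prod_single rename_monom_def perm_sign_def mult.commute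
      del: power_Suc)

lemma perm_poly_eq_sum:
  "perm_poly \<sigma> f =
    (\<Sum>a\<in>keys f. single (rename_monom ((`) \<sigma>) a) (perm_sign \<sigma> a * lookup f a))"
proof -
  have "perm_poly \<sigma> f = perm_poly \<sigma> (\<Sum>a\<in>keys f. single a (lookup f a))"
    using poly_eq_sum_singles[of f] by simp
  also have "\<dots> = (\<Sum>a\<in>keys f. perm_poly \<sigma> (single a (lookup f a)))"
    by (simp add: perm_poly_def poly_subst_sum)
  finally show ?thesis by (simp add: perm_poly_single)
qed

lemma inj_image: "inj \<sigma> \<Longrightarrow> inj ((`) \<sigma>)"
  by (simp add: inj_on_def inj_image_eq_iff)

context
  fixes \<sigma> :: "nat \<Rightarrow> nat"
  assumes inj: "inj \<sigma>"
begin

abbreviation (input) ren :: "(nat set \<Rightarrow>\<^sub>0 nat) \<Rightarrow> (nat set \<Rightarrow>\<^sub>0 nat)" where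
  "ren \<equiv> rename_monom ((`) \<sigma>)"

lemma lookup_perm_poly: "lookup (perm_poly \<sigma> f) (ren a) = perm_sign \<sigma> a * lookup f a"
proof -
  have "lookup (perm_poly \<sigma> f) (ren a) =
      (\<Sum>b\<in>keys f. perm_sign \<sigma> b * lookup f b when b = a)"
    using inj_rename_monom[OF inj_image[OF inj]]
    by (simp add: perm_poly_eq_sum lookup_sum lookup_single inj_eq)
  also have "\<dots> = perm_sign \<sigma> a * lookup f a"
    by (auto simp: when_def in_keys_iff)
  finally show ?thesis .
qed

lemma keys_perm_poly: "keys (perm_poly \<sigma> f) = ren ` keys f"
proof
  show "keys (perm_poly \<sigma> f) \<subseteq> ren ` keys f"
    unfolding perm_poly_eq_sum using Poly_Mapping.keys_sum by (fastforce split: if_splits)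
  show "ren ` keys f \<subseteq> keys (perm_poly \<sigma> f)"
    by (auto simp: in_keys_iff lookup_perm_poly)
qed

text \<open>The support is carried over bijectively, since \<open>ren\<close> is injective and the
  signs are nonzero; if comparisons correspond, so do the minimal monomials.\<close>

lemma perm_poly_initial_form:
  assumes "\<And>a b. lt' (ren a) (ren b) \<longleftrightarrow> lt a b"
  shows "perm_poly \<sigma> (initial_form lt f) = initial_form lt' (perm_poly \<sigma> f)"
proof -
  let ?S = "{a \<in> keys f. \<forall>b\<in>keys f. \<not> lt b a}"
  have "{a \<in> keys (perm_poly \<sigma> f). \<forall>b\<in>keys (perm_poly \<sigma> f). \<not> lt' b a} = ren ` ?S"
    using assms by (auto simp: keys_perm_poly)
  moreover have "inj_on ren ?S"
    using inj_rename_monom[OF inj_image[OF inj]] by (rule inj_on_subset) simp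
  ultimately have "initial_form lt' (perm_poly \<sigma> f) =
      (\<Sum>a\<in>?S. single (ren a) (perm_sign \<sigma> a * lookup f a))"
    by (simp add: initial_form_def sum.reindex lookup_perm_poly)
  also have "\<dots> = perm_poly \<sigma> (initial_form lt f)"
    unfolding initial_form_def perm_poly_def poly_subst_sum
    by (simp add: perm_poly_single flip: perm_poly_def)
  finally show ?thesis ..
qed

lemma weight_of_perm: "weight_of (perm_weight \<sigma> w) (ren a) = weight_of w a"
proof -
  have "weight_of (perm_weight \<sigma> w) (ren a) =
      (\<Sum>J\<in>keys a. perm_weight \<sigma> w (\<sigma> ` J) * real (lookup (ren a) (\<sigma> ` J)))"
    unfolding weight_of_def keys_rename_monom[OF inj_image[OF inj]]
    by (subst sum.reindex) (use inj_on_subset[OF inj_image[OF inj]] in auto)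
  also have "\<dots> = weight_of w a"
    by (simp add: weight_of_def lookup_rename_monom[OF inj_image[OF inj]] perm_weight_def
        image_inv_f_f[OF inj])
  finally show ?thesis .
qed

end

section \<open>Invariance of the Pluecker ideal and transport of its initial ideals\<close>

lemma permutes_image_plucker_index:
  assumes "\<sigma> permutes {1..n}" "J \<in> plucker_index n"
  shows "\<sigma> ` J \<in> plucker_index n"
proof -
  have "\<sigma> ` J \<noteq> \<sigma> ` {1..n}"
    using assms by (simp add: plucker_index_def inj_image_eq_iff permutes_inj psubset_eq)
  then show ?thesis
    using assms permutes_image[OF assms(1)] by (auto simp: plucker_index_def)
qed

lemma perm_poly_in_carrier:
  assumes "\<sigma> permutes {1..n}" "f \<in> carrier (plucker_ring n)"
  shows "perm_poly \<sigma> f \<in> carrier (plucker_ring n)"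
  using assms permutes_image_plucker_index[OF assms(1)] permutes_inj[OF assms(1)]
  by (fastforce simp: plucker_ring_def keys_perm_poly keys_rename_monom inj_image)

text \<open>Evaluating \<open>perm_poly \<sigma> f\<close> at the flag minors amounts to evaluating
  \<open>f\<close> there and then permuting the rows of the generic matrix, which keeps zero at
  zero.\<close>

lemma perm_poly_plucker_ideal:
  assumes \<sigma>: "\<sigma> permutes {1..n}" and f: "f \<in> plucker_ideal n"
  shows "perm_poly \<sigma> f \<in> plucker_ideal n"
proof -
  let ?\<rho> = "\<lambda>(r, c). indet (\<sigma> r, c) :: (nat \<times> nat) real_mpoly"
  have "poly_subst flag_minor (perm_poly \<sigma> f) =
      poly_subst (\<lambda>J. (- 1) ^ inversions (map \<sigma> (sorted_list_of_set J)) * flag_minor (\<sigma> ` J)) f"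
    by (simp add: perm_poly_def poly_subst_poly_subst poly_subst.hom_mult poly_subst.hom_power
        poly_subst.hom_uminus)
  also have "\<dots> = poly_subst (\<lambda>J. poly_subst ?\<rho> (flag_minor J)) f"
  \<comment> \<open>The sign rule for minors needs finite index sets, so the two substitutions are
    compared only on variables occurring in \<open>f\<close>.\<close>
  proof (rule poly_subst_cong)
    fix a J
    assume "a \<in> keys f" "J \<in> keys a"
    then have "J \<in> plucker_index n"
      using f by (auto simp: plucker_ideal_def plucker_ring_def)
    then have "finite J"
      unfolding plucker_index_def using finite_subset[of J "{1..n}"] by auto
    then show "(- 1) ^ inversions (map \<sigma> (sorted_list_of_set J)) * flag_minor (\<sigma> ` J) =
        poly_subst ?\<rho> (flag_minor J)"
      using poly_subst_rename_flag_minor permutes_inj[OF \<sigma>] by metis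
  qed
  also have "\<dots> = poly_subst ?\<rho> (poly_subst flag_minor f)"
    by (simp add: poly_subst_poly_subst)
  also have "\<dots> = 0"
    using f by (simp add: plucker_ideal_def)
  finally show ?thesis
    using f perm_poly_in_carrier[OF \<sigma>] by (simp add: plucker_ideal_def)
qed

text \<open>The preimage under \<sigma> of any ideal containing \<open>S'\<close> is an ideal
  containing \<open>S\<close>, and so contains \<open>h\<close>.\<close>

lemma perm_poly_genideal:
  assumes \<sigma>: "\<sigma> permutes {1..n}" and S: "S \<subseteq> carrier (plucker_ring n)"
    and im: "perm_poly \<sigma> ` S \<subseteq> S'"
    and h: "h \<in> genideal (plucker_ring n) S"
  shows "perm_poly \<sigma> h \<in> genideal (plucker_ring n) S'"
  unfolding genideal_def
proof (rule InterI, clarify)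
  fix I
  assume I: "ideal I (plucker_ring n)" and "S' \<subseteq> I"
  \<comment> \<open>The ring axioms of \<open>plucker_ring n\<close> are taken from here: the locale
    of ideals includes them for the ambient structure.\<close>
  interpret ideal I "plucker_ring n" by fact
  interpret ring_hom_ring "plucker_ring n" "plucker_ring n" "perm_poly \<sigma>"
    by (intro ring_hom_ringI ring_axioms)
      (use perm_poly_in_carrier[OF \<sigma>] in
        \<open>auto simp: plucker_ring_def perm_poly_def poly_subst.hom_mult poly_subst.hom_add\<close>)
  have "ideal {r \<in> carrier (plucker_ring n). perm_poly \<sigma> r \<in> I} (plucker_ring n)"
    using ideal_vimage[OF I] .
  moreover have "S \<subseteq> {r \<in> carrier (plucker_ring n). perm_poly \<sigma> r \<in> I}"
    using S im \<open>S' \<subseteq> I\<close> by auto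
  ultimately show "perm_poly \<sigma> h \<in> I"
    using h unfolding genideal_def by blast
qed

lemma keys_initial_form: "keys (initial_form lt f) \<subseteq> keys f"
  unfolding initial_form_def using Poly_Mapping.keys_sum by (fastforce split: if_splits)

lemma initial_form_in_carrier:
  "f \<in> carrier (plucker_ring n) \<Longrightarrow> initial_form lt f \<in> carrier (plucker_ring n)"
  using keys_initial_form[of lt f] by (auto simp: plucker_ring_def)

lemma perm_poly_in_weight:
  assumes \<sigma>: "\<sigma> permutes {1..n}" and h: "h \<in> in_weight n w (plucker_ideal n)"
  shows "perm_poly \<sigma> h \<in> in_weight n (perm_weight \<sigma> w) (plucker_ideal n)"
  using \<sigma> _ _ h unfolding in_weight_def initial_ideal_def
proof (rule perm_poly_genideal)
  let ?lt = "\<lambda>w a b. weight_of w a < weight_of w b"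
  show "initial_form (?lt w) ` plucker_ideal n \<subseteq> carrier (plucker_ring n)"
    using initial_form_in_carrier by (auto simp: plucker_ideal_def)
  show "perm_poly \<sigma> ` initial_form (?lt w) ` plucker_ideal n
      \<subseteq> initial_form (?lt (perm_weight \<sigma> w)) ` plucker_ideal n"
  proof clarify
    fix f assume "f \<in> plucker_ideal n"
    then have "perm_poly \<sigma> f \<in> plucker_ideal n"
      by (rule perm_poly_plucker_ideal[OF \<sigma>])
    moreover have "perm_poly \<sigma> (initial_form (?lt w) f) =
        initial_form (?lt (perm_weight \<sigma> w)) (perm_poly \<sigma> f)"
      using permutes_inj[OF \<sigma>] by (intro perm_poly_initial_form) (simp_all add: weight_of_perm)
    ultimately show "perm_poly \<sigma> (initial_form (?lt w) f)
        \<in> initial_form (?lt (perm_weight \<sigma> w)) ` plucker_ideal n"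
      by simp
  qed
qed

section \<open>The columns of the FFLV matrix\<close>

definition basis_vec :: "nat set \<Rightarrow> real \<Rightarrow> nat set \<Rightarrow> real" where
  "basis_vec L c = (\<lambda>K. if K = L then c else 0)"

text \<open>The graph of a bijection from \<open>A\<close> to \<open>B\<close>, kept as a set of
  pairs so that it can be read as a set of roots.\<close>

definition matching :: "('a \<times> 'b) set \<Rightarrow> 'a set \<Rightarrow> 'b set \<Rightarrow> bool" where
  "matching R A B \<longleftrightarrow> inj_on fst R \<and> inj_on snd R \<and> fst ` R = A \<and> snd ` R = B"

definition root_ind :: "(nat \<times> nat) set \<Rightarrow> nat \<times> nat \<Rightarrow> nat" where
  "root_ind R r = of_bool (r \<in> R)"

lemma wedge_list_sorted: "finite L \<Longrightarrow> wedge_list (sorted_list_of_set L) = basis_vec L 1"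
  by (auto simp: wedge_list_def basis_vec_def inversions_sorted fun_eq_iff)

lemma wedge_list_upt: "wedge_list [1..<Suc l] = basis_vec {1..l} 1"
proof -
  have "[1..<Suc l] = sorted_list_of_set {1..l}"
    by (simp add: atLeastLessThanSuc_atLeastAtMost[symmetric] del: upt_Suc)
  then show ?thesis using wedge_list_sorted[of "{1..l}"] by simp
qed

lemma root_op_basis_vec:
  assumes L: "L \<subseteq> {1..n}" and i: "i \<in> L" and j: "j \<notin> L" and c: "c \<noteq> 0"
  shows "\<exists>c'. c' \<noteq> 0 \<and> root_op n (i, j) (basis_vec L c) = basis_vec (insert j (L - {i})) c'"
proof -
  define ks where "ks = sorted_list_of_set L"
  have fin: "finite L" using L finite_subset by blast
  have ks: "distinct ks" "set ks = L" "length ks = card L"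
    using fin by (simp_all add: ks_def)
  obtain t where t: "t < card L" "ks ! t = i"
    using i ks by (metis in_set_conv_nth)
  then have T: "{s. s < card L \<and> ks ! s = i} = {t}"
    using ks by (auto simp: nth_eq_iff_index_eq)
  have dist: "distinct (ks[t := j])" and st: "set (ks[t := j]) = insert j (L - {i})"
    using t ks j by (auto simp: set_update_distinct intro!: distinct_list_update)
  have "root_op n (i, j) (basis_vec L c) K = c * wedge_list (ks[t := j]) K" for K
  proof -
    have "root_op n (i, j) (basis_vec L c) K = (\<Sum>L'\<in>Pow {1..n}. if L' = L then
        c * (\<Sum>t\<in>{t. t < card L \<and> ks ! t = i}. wedge_list (ks[t := j]) K) else 0)"
      unfolding root_op_def basis_vec_def ks_def by (intro sum.cong) auto
    also have "\<dots> = c * wedge_list (ks[t := j]) K"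
      using L T by (simp add: sum.delta)
    finally show ?thesis .
  qed
  then have "root_op n (i, j) (basis_vec L c) =
      basis_vec (insert j (L - {i})) (c * (- 1) ^ inversions (ks[t := j]))"
    by (auto simp: fun_eq_iff wedge_list_def basis_vec_def dist st)
  then show ?thesis using c by (intro exI conjI) auto
qed

text \<open>Sources are distinct and lie in \<open>L\<close>, targets are distinct and lie outside:
  each root of \<open>R\<close> finds its source still present and its target still absent, so no
  step vanishes. The induction runs over suffixes of the list, whence the intersections with
  \<open>set rs\<close>.\<close>

lemma ordered_monomial_op_matching:
  assumes "distinct rs" and R: "matching R A B"
    and "A \<subseteq> L" "B \<inter> L = {}" "L \<subseteq> {1..n}" "B \<subseteq> {1..n}"
  shows "\<exists>c. c \<noteq> 0 \<and> ordered_monomial_op n rs (root_ind R) (basis_vec L 1) =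
    basis_vec (L - fst ` (R \<inter> set rs) \<union> snd ` (R \<inter> set rs)) c"
  using \<open>distinct rs\<close> unfolding ordered_monomial_op_def
proof (induction rs)
  case Nil
  then show ?case by (auto intro!: exI[of _ 1])
next
  case (Cons r rs)
  let ?L = "L - fst ` (R \<inter> set rs) \<union> snd ` (R \<inter> set rs)"
  obtain c where c: "c \<noteq> 0"
      "foldr (\<lambda>r. root_op n r ^^ root_ind R r) rs (basis_vec L 1) = basis_vec ?L c"
    using Cons by auto
  show ?case
  proof (cases "r \<in> R")
    case False
    then show ?thesis using c by (auto simp: root_ind_def)
  next
    case True
    obtain i j where r: "r = (i, j)" by fastforce
    have sub: "fst ` R = A" "snd ` R = B" using R by (auto simp: matching_def)
    have ij: "i \<in> A" "j \<in> B" using sub True r by force+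
    have notin: "(i, j) \<notin> set rs" using Cons.prems r by simp
    have inj: "inj_on fst R" "inj_on snd R" using R by (auto simp: matching_def)
    \<comment> \<open>No root applied earlier has consumed \<open>i\<close>, by injectivity of the
      sources.\<close>
    have i': "i \<notin> fst ` (R \<inter> set rs)"
      using inj_onD[OF inj(1) _ True] notin r by force
    have j': "j \<notin> snd ` (R \<inter> set rs)"
      using inj_onD[OF inj(2) _ True] notin r by force
    have "fst ` (R \<inter> set rs) \<subseteq> A" "snd ` (R \<inter> set rs) \<subseteq> B" using sub by auto
    then have "?L \<subseteq> {1..n}" "i \<in> ?L" "j \<notin> ?L"
      and L': "insert j (?L - {i}) =
        L - fst ` (R \<inter> set (r # rs)) \<union> snd ` (R \<inter> set (r # rs))"
      using assms ij i' j' True r by auto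
    then show ?thesis
      using root_op_basis_vec[of ?L n i j c] c True r
      by (simp add: root_ind_def)
  qed
qed

section \<open>Weights of ordered monomials\<close>

lemma root_op_nonzero:
  assumes nz: "root_op n r v K \<noteq> 0" and r: "fst r \<noteq> snd r"
  shows "\<exists>L. v L \<noteq> 0 \<and> fst r \<in> L \<and> snd r \<notin> L \<and> K = insert (snd r) (L - {fst r})"
proof -
  obtain L where L: "L \<subseteq> {1..n}" and vL: "v L \<noteq> 0"
    and S: "(\<Sum>t\<in>{t. t < card L \<and> sorted_list_of_set L ! t = fst r}.
        wedge_list ((sorted_list_of_set L)[t := snd r]) K) \<noteq> 0"
    using nz unfolding root_op_def by (elim sum.not_neutral_contains_not_neutral) auto
  define ks where "ks = sorted_list_of_set L"
  have fin: "finite L" using L finite_subset by blast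
  have ks: "distinct ks" "set ks = L" "length ks = card L"
    using fin by (simp_all add: ks_def)
  obtain t where t: "t < card L" "ks ! t = fst r" and w: "wedge_list (ks[t := snd r]) K \<noteq> 0"
    using S unfolding ks_def by (elim sum.not_neutral_contains_not_neutral) auto
  from w have d: "distinct (ks[t := snd r])" and K: "K = set (ks[t := snd r])"
    by (auto simp: wedge_list_def split: if_splits)
  \<comment> \<open>Otherwise the wedge product would contain this factor twice and vanish.\<close>
  have "snd r \<notin> L"
  proof
    assume "snd r \<in> L"
    then obtain u where u: "u < card L" "ks ! u = snd r" using ks by (metis in_set_conv_nth)
    then have "u \<noteq> t" using t r by auto
    then show False
      using d t u ks nth_eq_iff_index_eq[OF d, of u t] by simp
  qed
  moreover have "fst r \<in> L" using t ks by (metis nth_mem)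
  moreover have "K = insert (snd r) (L - {fst r})"
    using K t ks by (simp add: set_update_distinct)
  ultimately show ?thesis using vL by blast
qed

text \<open>The weight of a basis vector is the indicator of its index set, taken in the integers;
  each application of the operator adds the unit vector at \<open>snd r\<close> and subtracts the
  one at \<open>fst r\<close>.\<close>

lemma root_op_power_weight:
  assumes "(root_op n r ^^ m) v K \<noteq> 0" and r: "fst r \<noteq> snd r"
  shows "\<exists>L. v L \<noteq> 0 \<and> (\<forall>x. (of_bool (x \<in> K) :: int) = of_bool (x \<in> L)
    + int m * (of_bool (snd r = x) - of_bool (fst r = x)))"
  using assms(1)
proof (induction m arbitrary: K)
  case 0
  then show ?case by auto
next
  case (Suc m)
  then obtain L where L: "(root_op n r ^^ m) v L \<noteq> 0" "fst r \<in> L" "snd r \<notin> L"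
      "K = insert (snd r) (L - {fst r})"
    using root_op_nonzero[OF _ r] by fastforce
  obtain L' where L': "v L' \<noteq> 0" "\<forall>x. of_bool (x \<in> L) = of_bool (x \<in> L')
      + int m * (of_bool (snd r = x) - of_bool (fst r = x))"
    using Suc.IH[OF L(1)] by blast
  have "of_bool (x \<in> K) = of_bool (x \<in> L) + (of_bool (snd r = x) - of_bool (fst r = x) :: int)" for x
    using L r by auto
  then show ?case using L' by (intro exI[of _ L']) (simp add: algebra_simps)
qed

lemma ordered_monomial_op_weight:
  fixes a :: "nat \<times> nat \<Rightarrow> nat" and rs :: "(nat \<times> nat) list"
  assumes "ordered_monomial_op n rs a v K \<noteq> 0" "distinct rs" "\<forall>r\<in>set rs. fst r \<noteq> snd r"
  shows "\<exists>L. v L \<noteq> 0 \<and> (\<forall>x. (of_bool (x \<in> K) :: int) = of_bool (x \<in> L)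
    + (\<Sum>r\<in>set rs. int (a r) * (of_bool (snd r = x) - of_bool (fst r = x))))"
  using assms
proof (induction rs arbitrary: K)
  case Nil
  then show ?case by (auto simp: ordered_monomial_op_def)
next
  case (Cons r rs)
  obtain L where L: "ordered_monomial_op n rs a v L \<noteq> 0" "\<forall>x. of_bool (x \<in> K) = of_bool (x \<in> L)
      + int (a r) * (of_bool (snd r = x) - of_bool (fst r = x))"
    using root_op_power_weight[of "a r" n r "ordered_monomial_op n rs a v" K] Cons.prems
    by (auto simp: ordered_monomial_op_def)
  obtain L' where "v L' \<noteq> 0" "\<forall>x. of_bool (x \<in> L) = of_bool (x \<in> L')
      + (\<Sum>r\<in>set rs. int (a r) * (of_bool (snd r = x) - of_bool (fst r = x)))"
    using Cons.IH[OF L(1)] Cons.prems by auto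
  then show ?case using L(2) Cons.prems by (intro exI[of _ L']) auto
qed

section \<open>Exponents of least degree\<close>

lemma good_root_sequence_root:
  "good_root_sequence n rs \<Longrightarrow> r \<in> set rs \<longleftrightarrow> 1 \<le> fst r \<and> fst r < snd r \<and> snd r \<le> n"
  by (cases r) (simp add: good_root_sequence_def)

lemma good_root_sequence_less:
  assumes "good_root_sequence n rs" "k < length rs" "l < length rs"
    and "snd (rs ! l) - fst (rs ! l) < snd (rs ! k) - fst (rs ! k)"
  shows "k < l"
  using assms unfolding good_root_sequence_def by blast

lemma hom_right_lex_asym: "hom_right_lex rs a b \<Longrightarrow> \<not> hom_right_lex rs b a"
  unfolding hom_right_lex_def by (metis less_asym' linorder_neqE_nat less_irrefl_nat)

lemma fflv_exponents_weight:
  assumes rs: "good_root_sequence n rs" and b: "b \<in> fflv_exponents n rs J"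
    and J: "finite J"
  shows "(of_bool (x \<in> J) :: int) = of_bool (x \<in> {1..card J})
    + int (\<Sum>r\<in>set rs. b r * of_bool (snd r = x)) - int (\<Sum>r\<in>set rs. b r * of_bool (fst r = x))"
proof -
  obtain c where c: "c \<noteq> 0" "ordered_monomial_op n rs b (wedge_list [1..<Suc (card J)]) =
      (\<lambda>K. c * wedge_list (sorted_list_of_set J) K)"
    using b by (auto simp: fflv_exponents_def)
  have "ordered_monomial_op n rs b (basis_vec {1..card J} 1) J = c"
    using c(2) unfolding wedge_list_upt wedge_list_sorted[OF J] by (simp add: basis_vec_def)
  then have "ordered_monomial_op n rs b (basis_vec {1..card J} 1) J \<noteq> 0"
    using c(1) by simp
  moreover have "distinct rs" "\<forall>r\<in>set rs. fst r \<noteq> snd r"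
    using rs by (auto simp: good_root_sequence_def)
  ultimately obtain L where "basis_vec {1..card J} 1 L \<noteq> 0" and
    *: "\<forall>x. of_bool (x \<in> J) = of_bool (x \<in> L)
      + (\<Sum>r\<in>set rs. int (b r) * (of_bool (snd r = x) - of_bool (fst r = x)))"
    using ordered_monomial_op_weight[of n rs b "basis_vec {1..card J} 1" J] by blast
  then have "L = {1..card J}" by (auto simp: basis_vec_def split: if_splits)
  with * show ?thesis by (simp add: right_diff_distrib sum_subtractf)
qed

text \<open>View \<open>b\<close> as edge multiplicities, with in-degree \<open>inc\<close> and
  out-degree \<open>out\<close>. The weight count gives \<open>inc x = 1 + out x\<close> on
  \<open>B\<close>; summing over \<open>B\<close> shows that the degree is at least
  \<open>card B\<close>. Under \<open>deg\<close> equality holds, so every edge ends in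
  \<open>B\<close> and none starts there, and the degrees become the indicators of \<open>B\<close>
  and \<open>A\<close>.\<close>

lemma fflv_exponents_matching:
  assumes rs: "good_root_sequence n rs" and b: "b \<in> fflv_exponents n rs J" and J: "finite J"
    and deg: "(\<Sum>r\<in>set rs. b r) \<le> card (J - {1..card J})"
  shows "\<exists>R. R \<subseteq> set rs \<and> b = root_ind R \<and> matching R ({1..card J} - J) (J - {1..card J})"
proof -
  define A B where "A = {1..card J} - J" and "B = J - {1..card J}"
  define inc out where "inc = (\<lambda>x. \<Sum>r\<in>set rs. b r * of_bool (snd r = x))"
    and "out = (\<lambda>x. \<Sum>r\<in>set rs. b r * of_bool (fst r = x))"
  have wt: "(of_bool (x \<in> J) :: int) = of_bool (x \<in> {1..card J}) + int (inc x) - int (out x)" for x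
    using fflv_exponents_weight[OF rs b J] by (simp add: inc_def out_def)
  have finB: "finite B" using J by (simp add: B_def)
  have incB: "inc x = 1 + out x" if "x \<in> B" for x
    using wt[of x] that by (auto simp: B_def)
  have "(\<Sum>x\<in>B. inc x) = (\<Sum>r\<in>set rs. b r * of_bool (snd r \<in> B))"
    unfolding inc_def using finB
    by (subst sum.swap) (simp add: sum_distrib_left[symmetric] of_bool_def sum.delta)
  moreover have "(\<Sum>x\<in>B. inc x) = card B + (\<Sum>x\<in>B. out x)"
    using sum.cong[OF refl incB, of B] by (simp only: sum.distrib) simp
  moreover have "(\<Sum>r\<in>set rs. b r) = (\<Sum>r\<in>set rs. b r * of_bool (snd r \<in> B))
      + (\<Sum>r\<in>set rs. b r * of_bool (snd r \<notin> B))"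
    by (subst sum.distrib[symmetric], intro sum.cong) auto
  ultimately have zero:
    "(\<Sum>r\<in>set rs. b r * of_bool (snd r \<notin> B)) = 0" "(\<Sum>x\<in>B. out x) = 0"
    using deg unfolding B_def[symmetric] by linarith+
  have sndB: "snd r \<in> B" if "r \<in> set rs" "b r \<noteq> 0" for r
    using zero(1) that by (cases "snd r \<in> B") auto
  have outB: "out x = 0" if "x \<in> B" for x
    using zero(2) that finB by auto
  have inc1: "inc x = 1" if "x \<in> B" for x using incB outB that by simp
  have inc0: "inc x = 0" if "x \<notin> B" for x
    unfolding inc_def using sndB that by (auto intro!: sum.neutral)
  have outA: "out x = of_bool (x \<in> A)" for x
  proof (cases "x \<in> B")
    case True
    then show ?thesis using outB by (simp add: A_def B_def)
  next
    case False
    then show ?thesis using wt[of x] inc0[of x] by (auto simp: A_def B_def split: if_splits)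
  qed
  define R where "R = {r \<in> set rs. b r \<noteq> 0}"
  \<comment> \<open>The coordinate \<open>f\<close> is left open to cover both common targets and
    common sources.\<close>
  have two: "b r + b r' \<le> (\<Sum>r\<in>set rs. b r * of_bool (f r = x))"
    if "r \<in> R" "r' \<in> R" "r \<noteq> r'" "f r = x" "f r' = x" for r r' x and f :: "nat \<times> nat \<Rightarrow> nat"
  proof -
    have "(\<Sum>s\<in>{r, r'}. b s * of_bool (f s = x)) \<le> (\<Sum>r\<in>set rs. b r * of_bool (f r = x))"
      by (rule sum_mono2) (use that in \<open>auto simp: R_def\<close>)
    then show ?thesis using that by simp
  qed
  have one: "b r \<le> 1" if "r \<in> R" for r
  proof -
    have "b r * of_bool (snd r = snd r) \<le> inc (snd r)"
      unfolding inc_def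
      by (rule member_le_sum[where f = "\<lambda>s. b s * of_bool (snd s = snd r)"])
        (use that in \<open>auto simp: R_def\<close>)
    then show ?thesis using inc1[of "snd r"] inc0[of "snd r"] by (cases "snd r \<in> B") auto
  qed
  have pos: "b r > 0" if "r \<in> R" for r using that by (simp add: R_def)
  have "inj_on snd R"
  proof (rule inj_onI, rule ccontr)
    fix r r' assume *: "r \<in> R" "r' \<in> R" "snd r = snd r'" "r \<noteq> r'"
    have "b r + b r' \<le> inc (snd r)"
      unfolding inc_def by (rule two[OF *(1,2,4) refl *(3)[symmetric]])
    moreover have "inc (snd r) \<le> 1" using inc1 inc0 by (cases "snd r \<in> B") auto
    ultimately show False using pos[OF *(1)] pos[OF *(2)] by simp
  qed
  moreover have "inj_on fst R"
  proof (rule inj_onI, rule ccontr)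
    fix r r' assume *: "r \<in> R" "r' \<in> R" "fst r = fst r'" "r \<noteq> r'"
    have "b r + b r' \<le> out (fst r)"
      unfolding out_def by (rule two[OF *(1,2,4) refl *(3)[symmetric]])
    moreover have "out (fst r) \<le> 1" using outA by simp
    ultimately show False using pos[OF *(1)] pos[OF *(2)] by simp
  qed
  moreover have "x \<in> snd ` R \<longleftrightarrow> x \<in> B" for x
  proof -
    have "x \<in> snd ` R \<longleftrightarrow> inc x \<noteq> 0" by (auto simp: R_def inc_def)
    then show ?thesis using inc0 inc1 by (cases "x \<in> B") auto
  qed
  moreover have "x \<in> fst ` R \<longleftrightarrow> x \<in> A" for x
  proof -
    have "x \<in> fst ` R \<longleftrightarrow> out x \<noteq> 0" by (auto simp: R_def out_def)
    then show ?thesis using outA by simp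
  qed
  ultimately have "matching R A B" unfolding matching_def by blast
  moreover have "b = root_ind R"
  proof
    fix r show "b r = root_ind R r"
    proof (cases "r \<in> R")
      case True
      then show ?thesis using one[OF True] pos[OF True] by (simp add: root_ind_def)
    next
      case False
      moreover have "b r = 0" if "r \<notin> set rs"
        using b that unfolding fflv_exponents_def by blast
      ultimately show ?thesis by (auto simp: root_ind_def R_def)
    qed
  qed
  ultimately show ?thesis unfolding A_def B_def R_def by (intro exI[of _ R]) (auto simp: R_def)
qed

section \<open>Minimality of the order-preserving matching\<close>

lemma sum_root_ind:
  assumes "R \<subseteq> set rs"
  shows "(\<Sum>r\<in>set rs. root_ind R r) = card R"
  using assms by (simp add: root_ind_def Int_absorb1)

text \<open>Both exponents have the same degree, so the last root \<open>rs ! k\<close> on which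
  \<open>R\<close> and \<open>R'\<close> differ decides; it has to belong to
  \<open>R'\<close>.\<close>

lemma monotone_matching_least:
  assumes rs: "good_root_sequence n rs" and R: "R \<subseteq> set rs" "matching R A B"
    and R': "R' \<subseteq> set rs" "matching R' A B" and "R \<noteq> R'"
    and mono: "\<And>i j i' j'. (i, j) \<in> R \<Longrightarrow> (i', j') \<in> R \<Longrightarrow> i < i' \<Longrightarrow> j < j'"
  shows "hom_right_lex rs (root_ind R) (root_ind R')"
proof -
  let ?P = "\<lambda>k. k < length rs \<and> (rs ! k \<in> R \<longleftrightarrow> rs ! k \<notin> R')"
  have "\<exists>k. ?P k"
    using R(1) R'(1) \<open>R \<noteq> R'\<close>
    by (metis (no_types, lifting) in_set_conv_nth subset_iff subsetI subset_antisym)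
  then obtain k where k: "?P k" "\<And>l. ?P l \<Longrightarrow> l \<le> k"
    using Nat.ex_has_greatest_nat[of ?P _ "length rs"] by (metis less_imp_le)
  have above: "rs ! l \<in> R \<longleftrightarrow> rs ! l \<in> R'" if "k < l" "l < length rs" for l
    using k(2)[of l] that by auto
  \<comment> \<open>Shorter roots stand to the right of position \<open>k\<close>, where the two
    sets agree.\<close>
  have short: "r \<in> R \<longleftrightarrow> r \<in> R'" if "snd r - fst r < snd (rs ! k) - fst (rs ! k)" for r
  proof (cases "r \<in> set rs")
    case True
    then obtain l where "l < length rs" "r = rs ! l" by (metis in_set_conv_nth)
    then show ?thesis using above good_root_sequence_less[OF rs, of k l] k(1) that by blast
  next
    case False
    then show ?thesis using R(1) R'(1) by blast
  qed
  have lt: "x < y" if "(x, y) \<in> R \<union> R'" for x y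
    using that R(1) R'(1) good_root_sequence_root[OF rs, of "(x, y)"] by auto
  have fin: "finite R" "finite R'" using R(1) R'(1) finite_subset by blast+
  have fin': "finite A" "finite B" using R(2) fin by (auto simp: matching_def)
  have injR: "inj_on fst R" "inj_on snd R" "inj_on fst R'" "inj_on snd R'"
    and im: "fst ` R = A" "snd ` R = B" "fst ` R' = A" "snd ` R' = B"
    using R(2) R'(2) by (auto simp: matching_def)
  \<comment> \<open>Otherwise \<open>rs ! k = (i, j)\<close> lies in \<open>R\<close> only, and since \<open>R\<close> and \<open>R'\<close> agree on shorter roots,
    \<open>R'\<close> would match the elements \<open>\<le> j\<close> of \<open>B\<close> with elements \<open>< i\<close> of \<open>A\<close>, of which there are too few.\<close>
  have "rs ! k \<in> R'"
  proof (rule ccontr)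
    assume notR': "rs ! k \<notin> R'"
    obtain i j where ij: "rs ! k = (i, j)" by fastforce
    have ijR: "(i, j) \<in> R" "(i, j) \<notin> R'" using notR' k(1) ij by auto
    have short': "(x, y) \<in> R" if "(x, y) \<in> R'" "y - x < j - i" for x y
      using short[of "(x, y)"] that ij by simp
    have "i \<in> A" "j \<in> B" using im ijR(1) by (metis fst_conv snd_conv imageI)+
    then obtain i' j' where R'ij: "(i', j) \<in> R'" "(i, j') \<in> R'"
      using im by (metis imageE prod.collapse)
    \<comment> \<open>A larger \<open>i'\<close> would make \<open>(i', j)\<close> shorter than
      \<open>(i, j)\<close>, hence a second pair of \<open>R\<close> with target \<open>j\<close>.
      The bound on \<open>j'\<close> is dual.\<close>
    have i': "i' < i"
    proof (rule ccontr)
      assume "\<not> i' < i"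
      moreover have "i' \<noteq> i" using R'ij ijR by auto
      ultimately have "j - i' < j - i" using lt[of i' j] R'ij by auto
      then have "(i', j) \<in> R" using short' R'ij by blast
      then show False using inj_onD[OF injR(2) _ _ ijR(1), of "(i', j)"] \<open>i' \<noteq> i\<close> by simp
    qed
    have j': "j < j'"
    proof (rule ccontr)
      assume "\<not> j < j'"
      moreover have "j' \<noteq> j" using R'ij ijR by auto
      ultimately have "j' - i < j - i" using lt[of i j'] R'ij by auto
      then have "(i, j') \<in> R" using short' R'ij by blast
      then show False using inj_onD[OF injR(1) _ _ ijR(1), of "(i, j')"] \<open>j' \<noteq> j\<close> by simp
    qed
    \<comment> \<open>A pair of \<open>R'\<close> with \<open>x > i\<close> and
      \<open>y \<le> j\<close> would be shorter than \<open>(i, j)\<close>, hence in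
      \<open>R\<close>, where monotonicity gives \<open>j < y\<close>.\<close>
    have partner: "x < i" if "(x, y) \<in> R'" "y \<le> j" for x y
    proof (rule ccontr)
      assume "\<not> x < i"
      moreover have "x \<noteq> i"
        using inj_onD[OF injR(3) _ R'ij(2), of "(x, y)"] that j' by auto
      ultimately have "i < x" by simp
      moreover from this have "y - x < j - i" using lt[of x y] that by auto
      then have "(x, y) \<in> R" using short' that by blast
      ultimately show False using mono[OF ijR(1), of x y] that by simp
    qed
    \<comment> \<open>Through \<open>R'\<close> the elements of \<open>B\<close> up to
      \<open>j\<close> inject into the elements of \<open>A\<close> below \<open>i\<close>;
      \<open>R\<close> sends those to elements of \<open>B\<close> strictly below \<open>j\<close>,
      which are fewer.\<close>
    have "card {y \<in> B. y \<le> j} = card {r \<in> R'. snd r \<le> j}"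
    proof -
      have "{y \<in> B. y \<le> j} = snd ` {r \<in> R'. snd r \<le> j}"
        unfolding im(4)[symmetric] by auto
      then show ?thesis using inj_on_subset[OF injR(4)] by (simp add: card_image)
    qed
    also have "\<dots> = card (fst ` {r \<in> R'. snd r \<le> j})"
      using inj_on_subset[OF injR(3)] by (subst card_image) auto
    also have "\<dots> \<le> card {x \<in> A. x < i}"
      by (rule card_mono) (use fin' partner im in auto)
    also have "\<dots> = card {r \<in> R. fst r < i}"
    proof -
      have "{x \<in> A. x < i} = fst ` {r \<in> R. fst r < i}"
        unfolding im(1)[symmetric] by auto
      then show ?thesis using inj_on_subset[OF injR(1)] by (simp add: card_image)
    qed
    also have "\<dots> = card (snd ` {r \<in> R. fst r < i})"
      using inj_on_subset[OF injR(2)] by (subst card_image) auto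
    also have "\<dots> \<le> card {y \<in> B. y < j}"
      by (rule card_mono) (use fin' mono[OF _ ijR(1)] im in auto)
    also have "\<dots> < card {y \<in> B. y \<le> j}"
      by (rule psubset_card_mono) (use fin' \<open>j \<in> B\<close> in auto)
    finally show False by simp
  qed
  then have "root_ind R (rs ! k) < root_ind R' (rs ! k)"
    using k(1) by (simp add: root_ind_def)
  moreover have "root_ind R (rs ! l) = root_ind R' (rs ! l)" if "k < l" "l < length rs" for l
    using above[OF that] by (simp add: root_ind_def)
  moreover have "card R = card R'"
    using injR im card_image by metis
  ultimately show ?thesis
    unfolding hom_right_lex_def sum_root_ind[OF R(1)] sum_root_ind[OF R'(1)] using k(1) by blast
qed

text \<open>Reduces the description operator to exhibiting an order-preserving matching by roots.
  Competitors of degree at most that of \<open>R\<close> are matchings and lose by the previous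
  lemma; the others lose on degree.\<close>

lemma fflv_column_eq:
  assumes rs: "good_root_sequence n rs" and J: "J \<subseteq> {1..n}" and Rrs: "R \<subseteq> set rs"
    and R: "matching R ({1..card J} - J) (J - {1..card J})"
    and mono: "\<And>i j i' j'. (i, j) \<in> R \<Longrightarrow> (i', j') \<in> R \<Longrightarrow> i < i' \<Longrightarrow> j < j'"
  shows "fflv_column n rs J = root_ind R"
proof -
  have fin: "finite J" using J finite_subset by blast
  have cardJ: "card J \<le> n" using card_mono[OF _ J] by simp
  have "\<exists>c. c \<noteq> 0 \<and> ordered_monomial_op n rs (root_ind R) (basis_vec {1..card J} 1) =
      basis_vec ({1..card J} - fst ` (R \<inter> set rs) \<union> snd ` (R \<inter> set rs)) c"
    by (rule ordered_monomial_op_matching[OF _ R])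
      (use rs J cardJ in \<open>auto simp: good_root_sequence_def\<close>)
  moreover have "{1..card J} - fst ` (R \<inter> set rs) \<union> snd ` (R \<inter> set rs) = J"
    using R Rrs by (auto simp: matching_def Int_absorb2)
  ultimately obtain c where "c \<noteq> 0"
      "ordered_monomial_op n rs (root_ind R) (basis_vec {1..card J} 1) = basis_vec J c"
    by auto
  then have mem: "root_ind R \<in> fflv_exponents n rs J"
    unfolding fflv_exponents_def wedge_list_upt wedge_list_sorted[OF fin] using Rrs
    by (auto simp: root_ind_def basis_vec_def intro!: exI[of _ c])
  have least: "hom_right_lex rs (root_ind R) b"
    if b: "b \<in> fflv_exponents n rs J" "b \<noteq> root_ind R" for b
  proof (cases "(\<Sum>r\<in>set rs. b r) \<le> card (J - {1..card J})")
    case True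
    then obtain R' where "R' \<subseteq> set rs" "b = root_ind R'"
        "matching R' ({1..card J} - J) (J - {1..card J})"
      using fflv_exponents_matching[OF rs b(1) fin] by blast
    then show ?thesis
      using monotone_matching_least[OF rs Rrs R, of R'] mono b(2) by blast
  next
    case False
    moreover have "card R = card (J - {1..card J})"
      using R by (auto simp: matching_def dest: card_image)
    ultimately show ?thesis by (simp add: hom_right_lex_def sum_root_ind[OF Rrs])
  qed
  show ?thesis
    unfolding fflv_column_def
  proof (rule the_equality)
    show "root_ind R \<in> fflv_exponents n rs J \<and>
        (\<forall>b\<in>fflv_exponents n rs J. b \<noteq> root_ind R \<longrightarrow> hom_right_lex rs (root_ind R) b)"
      using mem least by blast
  next
    fix a
    assume "a \<in> fflv_exponents n rs J \<and>
      (\<forall>b\<in>fflv_exponents n rs J. b \<noteq> a \<longrightarrow> hom_right_lex rs a b)"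
    \<comment> \<open>Two distinct least exponents would each precede the other.\<close>
    then show "a = root_ind R" using mem least[of a] hom_right_lex_asym by metis
  qed
qed

section \<open>Three-term relations\<close>

text \<open>The conditional index skips column \<open>j\<close>; in this form simplification
  evaluates small determinants recursively.\<close>

lemma det_expand_first_row:
  "det (mat (Suc m) (Suc m) G) = (\<Sum>j<Suc m. G (0, j) * (- 1) ^ j *
    det (mat m m (\<lambda>(i, k). G (Suc i, if k < j then k else Suc k))))"
proof -
  let ?A = "mat (Suc m) (Suc m) G"
  have "mat_delete ?A 0 j = mat m m (\<lambda>(i, k). G (Suc i, if k < j then k else Suc k))" for j
    by (rule eq_matI) (auto simp: mat_delete_def)
  moreover have "det ?A = (\<Sum>j<Suc m. ?A $$ (0, j) * cofactor ?A 0 j)"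
    by (rule laplace_expansion_row) auto
  ultimately show ?thesis
    by (simp add: cofactor_def mult.assoc del: sum.lessThan_Suc)
qed

lemma rows_det_small:
  shows "rows_det F [a] = F a 0"
    and "rows_det F [a, b] = F a 0 * F b 1 - F a 1 * F b 0"
    and "rows_det F [a, b, c] = F a 0 * F b 1 * F c 2 - F a 0 * F b 2 * F c 1
      - F a 1 * F b 0 * F c 2 + F a 1 * F b 2 * F c 0
      + F a 2 * F b 0 * F c 1 - F a 2 * F b 1 * F c 0"
  by (simp_all add: rows_det_def det_expand_first_row numeral_2_eq_2 algebra_simps)

section \<open>Binomial initial forms of three-term relations\<close>

definition pair_monom :: "'v \<Rightarrow> 'v \<Rightarrow> ('v \<Rightarrow>\<^sub>0 nat)" where
  "pair_monom u v = single u 1 + single v 1"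

lemma keys_pair_monom: "u \<noteq> v \<Longrightarrow> keys (pair_monom u v) = {u, v}"
  by (auto simp: pair_monom_def in_keys_iff lookup_add lookup_single when_def split: if_splits)

lemma lookup_pair_monom:
  "u \<noteq> v \<Longrightarrow> lookup (pair_monom u v) u = 1" "u \<noteq> v \<Longrightarrow> lookup (pair_monom u v) v = 1"
  by (auto simp: pair_monom_def lookup_add lookup_single when_def)

lemma single_pair_monom: "single (pair_monom u v) c = single 0 c * indet u * indet v"
  by (simp add: pair_monom_def indet_def mult_single)

lemma fflv_mult_pair_monom:
  "A \<noteq> B \<Longrightarrow> fflv_mult n rs (pair_monom A B) = (\<lambda>r. fflv_column n rs A r + fflv_column n rs B r)"
  by (simp add: fflv_mult_def keys_pair_monom lookup_pair_monom fun_eq_iff)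

text \<open>The two index sets in each monomial used below differ in size, so their distinctness
  becomes a comparison of numerals.\<close>

lemma neq_of_card: "card A \<noteq> card B \<Longrightarrow> A \<noteq> B"
  by auto

lemma perm_sign_pair_monom:
  "A \<noteq> B \<Longrightarrow> perm_sign \<sigma> (pair_monom A B) =
    (- 1) ^ inversions (map \<sigma> (sorted_list_of_set A))
    * (- 1) ^ inversions (map \<sigma> (sorted_list_of_set B))"
  by (simp add: perm_sign_def keys_pair_monom lookup_pair_monom)

text \<open>Distinct monomials may tie: \<open>a\<close> and \<open>b\<close> are both minimal,
  while \<open>a\<close> eliminates \<open>c\<close>.\<close>

lemma initial_form_trinomial:
  assumes "a \<noteq> b" "a \<noteq> c" "b \<noteq> c" "x \<noteq> 0" "y \<noteq> 0" "z \<noteq> 0"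
    and "lt a c" "\<not> lt a a" "\<not> lt a b" "\<not> lt b a" "\<not> lt b b" "\<not> lt c a" "\<not> lt c b"
  shows "initial_form lt (single a x + single b y + single c z) = single a x + single b y"
proof -
  let ?f = "single a x + single b y + single c z"
  have "keys ?f = {a, b, c}"
    using assms by (auto simp: in_keys_iff lookup_add lookup_single when_def split: if_splits)
  then have "{u \<in> keys ?f. \<forall>v\<in>keys ?f. \<not> lt v u} = {a, b}"
    using assms by auto
  then show ?thesis
    using assms by (simp add: initial_form_def lookup_add lookup_single)
qed

text \<open>Everything to the right of \<open>r\<close> has height \<open>snd s - fst s\<close> at
  most that of \<open>r\<close>. Roots of equal height come in arbitrary order, so agreement is
  demanded on them too.\<close>

lemma hom_right_lexI:
  assumes rs: "good_root_sequence n rs" and r: "r \<in> set rs"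
    and "(\<Sum>s\<in>set rs. a s) = (\<Sum>s\<in>set rs. b s)" "a r < b r"
    and eq: "\<And>s. s \<in> set rs \<Longrightarrow> s \<noteq> r \<Longrightarrow> snd s - fst s \<le> snd r - fst r \<Longrightarrow> a s = b s"
  shows "hom_right_lex rs a b"
proof -
  obtain k where k: "k < length rs" "rs ! k = r" using r by (metis in_set_conv_nth)
  have "a (rs ! l) = b (rs ! l)" if "k < l" "l < length rs" for l
  proof (rule eq)
    show "rs ! l \<in> set rs" using that by simp
    show "rs ! l \<noteq> r"
      using rs that k by (auto simp: good_root_sequence_def nth_eq_iff_index_eq)
    show "snd (rs ! l) - fst (rs ! l) \<le> snd r - fst r"
      using good_root_sequence_less[OF rs, of l k] that k by force
  qed
  then show ?thesis using assms(3,4) k unfolding hom_right_lex_def by blast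
qed

lemma pair_relation_initial_form:
  assumes idx: "{A, B, C, D, E, F} \<subseteq> plucker_index n"
    and ne: "A \<noteq> B" "C \<noteq> D" "E \<noteq> F" "A \<notin> {C, D}"
    and coeff: "x \<noteq> 0" "y \<noteq> 0" "z \<noteq> 0"
    and rel: "single 0 x * flag_minor A * flag_minor B + single 0 y * flag_minor C * flag_minor D
      + single 0 z * flag_minor E * flag_minor F = 0"
    and eq: "\<And>r. fflv_column n rs A r + fflv_column n rs B r
      = fflv_column n rs C r + fflv_column n rs D r"
    and less: "hom_right_lex rs (\<lambda>r. fflv_column n rs A r + fflv_column n rs B r)
      (\<lambda>r. fflv_column n rs E r + fflv_column n rs F r)"
  shows "single (pair_monom A B) x + single (pair_monom C D) y \<in> I_FFLV n rs"
proof -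
  let ?a = "pair_monom A B" and ?b = "pair_monom C D" and ?c = "pair_monom E F"
  let ?f = "single ?a x + single ?b y + single ?c z"
  let ?lt = "\<lambda>a b. hom_right_lex rs (fflv_mult n rs a) (fflv_mult n rs b)"
  have ab: "fflv_mult n rs ?a = fflv_mult n rs ?b" and ac: "?lt ?a ?c"
    using eq less ne by (simp_all add: fflv_mult_pair_monom)
  have "keys ?f \<subseteq> {?a, ?b, ?c}"
    by (auto simp: in_keys_iff lookup_add lookup_single when_def split: if_splits)
  then have "\<forall>u\<in>keys ?f. keys u \<subseteq> plucker_index n"
    using idx keys_pair_monom[OF ne(1)] keys_pair_monom[OF ne(2)] keys_pair_monom[OF ne(3)]
    by auto
  moreover have "poly_subst flag_minor ?f = 0"
    using rel by (simp add: single_pair_monom poly_subst.hom_add poly_subst.hom_mult)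
  ultimately have "?f \<in> plucker_ideal n"
    by (simp add: plucker_ideal_def plucker_ring_def)
  then have "initial_form ?lt ?f \<in> I_FFLV n rs"
    unfolding I_FFLV_def initial_ideal_def genideal_def by blast
  moreover have "initial_form ?lt ?f = single ?a x + single ?b y"
  proof (rule initial_form_trinomial)
    \<comment> \<open>The first two monomials have the same image under the FFLV matrix, so they are
      told apart by their variables.\<close>
    have "A \<in> keys ?a" "A \<notin> keys ?b" using ne by (simp_all add: keys_pair_monom)
    then show "?a \<noteq> ?b" by metis
    show "?a \<noteq> ?c" "?b \<noteq> ?c" "\<not> ?lt ?a ?a" "\<not> ?lt ?a ?b" "\<not> ?lt ?b ?a" "\<not> ?lt ?b ?b"
      "\<not> ?lt ?c ?a" "\<not> ?lt ?c ?b" "?lt ?a ?c"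
      using ac ab hom_right_lex_asym by metis+
  qed (use coeff in auto)
  ultimately show ?thesis by simp
qed

lemma plucker_index_small:
  assumes "n \<ge> 5" "J \<subseteq> {1..5}" "J \<noteq> {}" "card J < 5"
  shows "J \<in> plucker_index n"
proof -
  have "J \<subseteq> {1..n}" using assms by auto
  moreover have "J \<noteq> {1..n}" using assms by auto
  ultimately show ?thesis using assms by (auto simp: plucker_index_def)
qed

section \<open>Columns and binomials for index sets inside {1,..,5}\<close>

context
  fixes n :: nat and rs :: "(nat \<times> nat) list"
  assumes n: "n \<ge> 5" and rs: "good_root_sequence n rs"
begin

lemma root_mem: "(i, j) \<in> set rs \<longleftrightarrow> 1 \<le> i \<and> i < j \<and> j \<le> n"
  using good_root_sequence_root[OF rs, of "(i, j)"] by simp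

lemma interval_small: "{1..1} = {1::nat}" "{1..2} = {1, 2::nat}" "{1..3} = {1, 2, 3::nat}"
  by auto

text \<open>Here and in the next two lemmas, the index sets are those occurring in the three
  relations.\<close>

lemma columns_1:
  "fflv_column n rs {1} = root_ind {}"
  "fflv_column n rs {2} = root_ind {(1, 2)}"
  "fflv_column n rs {5} = root_ind {(1, 5)}"
  using n by (auto intro!: fflv_column_eq[OF rs] simp: matching_def interval_small root_mem)

lemma columns_2:
  "fflv_column n rs {1, 2} = root_ind {}"
  "fflv_column n rs {1, 3} = root_ind {(2, 3)}"
  "fflv_column n rs {1, 4} = root_ind {(2, 4)}"
  "fflv_column n rs {1, 5} = root_ind {(2, 5)}"
  "fflv_column n rs {2, 3} = root_ind {(1, 3)}"
  "fflv_column n rs {2, 4} = root_ind {(1, 4)}"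
  "fflv_column n rs {2, 5} = root_ind {(1, 5)}"
  "fflv_column n rs {3, 5} = root_ind {(1, 3), (2, 5)}"
  "fflv_column n rs {4, 5} = root_ind {(1, 4), (2, 5)}"
  using n by (auto intro!: fflv_column_eq[OF rs] simp: matching_def interval_small root_mem)

lemma columns_3:
  "fflv_column n rs {1, 2, 3} = root_ind {}"
  "fflv_column n rs {1, 2, 4} = root_ind {(3, 4)}"
  "fflv_column n rs {1, 3, 5} = root_ind {(2, 5)}"
  "fflv_column n rs {2, 3, 5} = root_ind {(1, 5)}"
  "fflv_column n rs {1, 4, 5} = root_ind {(2, 4), (3, 5)}"
  "fflv_column n rs {2, 4, 5} = root_ind {(1, 4), (3, 5)}"
  using n by (auto intro!: fflv_column_eq[OF rs] simp: matching_def interval_small root_mem)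

lemmas columns = columns_1 columns_2 columns_3

lemma sum_root_ind_add:
  assumes "R \<subseteq> set rs" "S \<subseteq> set rs"
  shows "(\<Sum>r\<in>set rs. root_ind R r + root_ind S r) = card R + card S"
  using assms by (simp add: sum.distrib sum_root_ind)

text \<open>The omitted term \<open>p_2 p_15\<close> has degree 2, the other two have degree 1. The
  free scalar \<open>s\<close> later absorbs a common sign.\<close>

lemma I_FFLV_binomial_empty:
  assumes "s \<noteq> 0"
  shows "single (pair_monom {1} {2, 5}) s + single (pair_monom {5} {1, 2}) s
    \<in> I_FFLV n rs"
proof (rule pair_relation_initial_form[where E = "{2}" and F = "{1, 5}" and z = "- s"])
  show "hom_right_lex rs (\<lambda>r. fflv_column n rs {1} r + fflv_column n rs {2, 5} r)
      (\<lambda>r. fflv_column n rs {2} r + fflv_column n rs {1, 5} r)"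
    unfolding hom_right_lex_def columns
    by (rule disjI1) (use n in \<open>simp add: sum_root_ind_add root_mem\<close>)
  show "fflv_column n rs {1} r + fflv_column n rs {2, 5} r =
      fflv_column n rs {5} r + fflv_column n rs {1, 2} r" for r
    unfolding columns by (auto simp: root_ind_def)
  show "{1} \<notin> ({{5}, {1, 2}} :: nat set set)" "{1} \<noteq> ({2, 5} :: nat set)"
    "{5} \<noteq> ({1, 2} :: nat set)" "{2} \<noteq> ({1, 5} :: nat set)"
    by (auto simp: doubleton_eq_iff dest: arg_cong[of _ _ card])
  show "{{1}, {2, 5}, {5}, {1, 2}, {2}, {1, 5}} \<subseteq> plucker_index n"
    using n by (simp add: plucker_index_small)
qed (use assms in \<open>simp_all add: flag_minor_eq_rows_det rows_det_small single_uminus algebra_simps\<close>)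

text \<open>All three terms have degree 2, and only the omitted \<open>p_13 p_235\<close> involves
  the root \<open>(2, 3)\<close> of height one, which is compared before the longer roots.\<close>

lemma I_FFLV_binomial_3:
  assumes "s \<noteq> 0"
  shows "single (pair_monom {2, 3} {1, 3, 5}) (- s) + single (pair_monom {3, 5} {1, 2, 3}) s
    \<in> I_FFLV n rs"
proof (rule pair_relation_initial_form[where E = "{1, 3}" and F = "{2, 3, 5}" and z = "s"])
  show "hom_right_lex rs (\<lambda>r. fflv_column n rs {2, 3} r + fflv_column n rs {1, 3, 5} r)
      (\<lambda>r. fflv_column n rs {1, 3} r + fflv_column n rs {2, 3, 5} r)"
    unfolding columns
  proof (rule hom_right_lexI[OF rs, of "(2, 3)"])
    show "(\<Sum>s\<in>set rs. root_ind {(1, 3)} s + root_ind {(2, 5)} s) =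
        (\<Sum>s\<in>set rs. root_ind {(2, 3)} s + root_ind {(1, 5)} s)"
      by (subst (1 2) sum_root_ind_add) (use n in \<open>auto simp: root_mem\<close>)
  qed (use n in \<open>auto simp: root_mem root_ind_def\<close>)
  show "fflv_column n rs {2, 3} r + fflv_column n rs {1, 3, 5} r =
      fflv_column n rs {3, 5} r + fflv_column n rs {1, 2, 3} r" for r
    unfolding columns by (auto simp: root_ind_def)
  show "{2, 3} \<notin> ({{3, 5}, {1, 2, 3}} :: nat set set)" "{2, 3} \<noteq> ({1, 3, 5} :: nat set)"
    "{3, 5} \<noteq> ({1, 2, 3} :: nat set)" "{1, 3} \<noteq> ({2, 3, 5} :: nat set)"
    by (auto simp: doubleton_eq_iff dest: arg_cong[of _ _ card])
  show "{{2, 3}, {1, 3, 5}, {3, 5}, {1, 2, 3}, {1, 3}, {2, 3, 5}} \<subseteq> plucker_index n"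
    using n by (simp add: plucker_index_small)
qed (use assms in \<open>simp_all add: flag_minor_eq_rows_det rows_det_small single_uminus algebra_simps\<close>)

text \<open>All three terms have degree 3, and only the omitted \<open>p_45 p_124\<close> involves a
  root of height one, namely \<open>(3, 4)\<close>.\<close>

lemma I_FFLV_binomial_4:
  assumes "s \<noteq> 0"
  shows "single (pair_monom {1, 4} {2, 4, 5}) s + single (pair_monom {2, 4} {1, 4, 5}) (- s)
    \<in> I_FFLV n rs"
proof (rule pair_relation_initial_form[where E = "{4, 5}" and F = "{1, 2, 4}" and z = "s"])
  show "hom_right_lex rs (\<lambda>r. fflv_column n rs {1, 4} r + fflv_column n rs {2, 4, 5} r)
      (\<lambda>r. fflv_column n rs {4, 5} r + fflv_column n rs {1, 2, 4} r)"
    unfolding columns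
  proof (rule hom_right_lexI[OF rs, of "(3, 4)"])
    show "(\<Sum>s\<in>set rs. root_ind {(2, 4)} s + root_ind {(1, 4), (3, 5)} s) =
        (\<Sum>s\<in>set rs. root_ind {(1, 4), (2, 5)} s + root_ind {(3, 4)} s)"
      by (subst (1 2) sum_root_ind_add) (use n in \<open>auto simp: root_mem\<close>)
  qed (use n in \<open>auto simp: root_mem root_ind_def\<close>)
  show "fflv_column n rs {1, 4} r + fflv_column n rs {2, 4, 5} r =
      fflv_column n rs {2, 4} r + fflv_column n rs {1, 4, 5} r" for r
    unfolding columns by (auto simp: root_ind_def)
  show "{1, 4} \<notin> ({{2, 4}, {1, 4, 5}} :: nat set set)" "{1, 4} \<noteq> ({2, 4, 5} :: nat set)"
    "{2, 4} \<noteq> ({1, 4, 5} :: nat set)" "{4, 5} \<noteq> ({1, 2, 4} :: nat set)"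
    by (auto simp: doubleton_eq_iff dest: arg_cong[of _ _ card])
  show "{{1, 4}, {2, 4, 5}, {2, 4}, {1, 4, 5}, {4, 5}, {1, 2, 4}} \<subseteq> plucker_index n"
    using n by (simp add: plucker_index_small)
qed (use assms in \<open>simp_all add: flag_minor_eq_rows_det rows_det_small single_uminus algebra_simps\<close>)

end

section \<open>Signs after a permutation, and the conclusion\<close>

lemma perm_poly_binomial_nonneg:
  assumes mem: "\<And>s. s \<noteq> 0 \<Longrightarrow> single a (s * x) + single b (s * y) \<in> I"
    and pos: "(perm_sign \<sigma> a * x) * (perm_sign \<sigma> b * y) > 0"
  shows "\<exists>g\<in>I. perm_poly \<sigma> g \<noteq> 0 \<and> (\<forall>u. 0 \<le> lookup (perm_poly \<sigma> g) u)"
proof -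
  \<comment> \<open>With this scalar the coefficients after \<sigma> are the square of
    \<open>s\<close> and the product assumed positive.\<close>
  define s where "s = perm_sign \<sigma> a * x"
  have s: "s \<noteq> 0" using pos by (auto simp: s_def)
  define g where "g = single a (s * x) + single b (s * y)"
  define a' b' where "a' = rename_monom ((`) \<sigma>) a" and "b' = rename_monom ((`) \<sigma>) b"
  have g': "perm_poly \<sigma> g = single a' (s * s) + single b' (s * (perm_sign \<sigma> b * y))"
    using perm_poly_single[of \<sigma> a "s * x"] perm_poly_single[of \<sigma> b "s * y"]
    by (simp add: g_def perm_poly_def poly_subst_add a'_def b'_def s_def mult_ac)
  have ss: "s * s > 0" "s * (perm_sign \<sigma> b * y) > 0"
    using s not_real_square_gt_zero[of s] pos[folded s_def] by blast+
  have nonneg: "0 \<le> lookup (perm_poly \<sigma> g) u" for u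
    using ss by (simp add: g' lookup_add lookup_single when_def)
  \<comment> \<open>Positive coefficients cannot cancel, whether or not \<open>a'\<close> and
    \<open>b'\<close> coincide.\<close>
  have "lookup (perm_poly \<sigma> g) a' \<noteq> 0"
    using ss s by (simp add: g' lookup_add lookup_single when_def)
  then have "perm_poly \<sigma> g \<noteq> 0" by auto
  then show ?thesis using mem[OF s] nonneg unfolding g_def by blast
qed

text \<open>Comparisons with \<sigma>(3) or \<sigma>(4) occur equally often in both monomials of a
  binomial and cancel in the product of the two signs. Two comparisons among \<sigma>(1),
  \<sigma>(2), \<sigma>(5) remain, both involving the index of the omitted term.\<close>

lemma perm_poly_I_FFLV_nonneg:
  assumes n: "n \<ge> 5" and rs: "good_root_sequence n rs" and "inj \<sigma>"
  shows "\<exists>g\<in>I_FFLV n rs. perm_poly \<sigma> g \<noteq> 0 \<and> (\<forall>u. 0 \<le> lookup (perm_poly \<sigma> g) u)"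
proof -
  have "\<sigma> 1 \<noteq> \<sigma> 2" "\<sigma> 1 \<noteq> \<sigma> 5" "\<sigma> 2 \<noteq> \<sigma> 5"
    using \<open>inj \<sigma>\<close> by (simp_all add: inj_eq)
  \<comment> \<open>The cases say that the median is the value at 2, at 1 and at 5,
    respectively.\<close>
  then consider "\<sigma> 5 < \<sigma> 2 \<longleftrightarrow> \<sigma> 2 < \<sigma> 1" | "\<sigma> 2 < \<sigma> 1 \<longleftrightarrow> \<sigma> 1 < \<sigma> 5" | "\<sigma> 1 < \<sigma> 5 \<longleftrightarrow> \<sigma> 5 < \<sigma> 2"
    by linarith
  then show ?thesis
  proof cases
    case 1
    show ?thesis
      by (rule perm_poly_binomial_nonneg[where a = "pair_monom {1} {2, 5}" and x = 1
            and b = "pair_monom {5} {1, 2}" and y = 1])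
        (use I_FFLV_binomial_empty[OF n rs] 1 in
          \<open>auto simp: perm_sign_pair_monom[OF neq_of_card] inversions_Cons\<close>)
  next
    case 2
    show ?thesis
      by (rule perm_poly_binomial_nonneg[where a = "pair_monom {2, 3} {1, 3, 5}" and x = "- 1"
            and b = "pair_monom {3, 5} {1, 2, 3}" and y = 1])
        (use I_FFLV_binomial_3[OF n rs] 2 \<open>\<sigma> 1 \<noteq> \<sigma> 5\<close> in
          \<open>auto simp: perm_sign_pair_monom[OF neq_of_card] inversions_Cons\<close>)
  next
    case 3
    show ?thesis
      by (rule perm_poly_binomial_nonneg[where a = "pair_monom {1, 4} {2, 4, 5}" and x = 1
            and b = "pair_monom {2, 4} {1, 4, 5}" and y = "- 1"])
        (use I_FFLV_binomial_4[OF n rs] 3 \<open>\<sigma> 1 \<noteq> \<sigma> 5\<close> in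
          \<open>auto simp: perm_sign_pair_monom[OF neq_of_card] inversions_Cons\<close>)
  qed
qed

theorem theorem5p10:
  fixes n :: nat and rs :: "(nat \<times> nat) list"
  assumes "n \<ge> 5"
    and "good_root_sequence n rs"
  shows "(\<forall>\<sigma>. \<sigma> permutes {1..n} \<longrightarrow>
            perm_weight \<sigma> ` C_FFLV_rel_interior n rs \<inter> Trop_pos n (plucker_ideal n) = {})
       \<and> \<not> (\<exists>\<sigma>. \<sigma> permutes {1..n} \<and> totally_positive (perm_poly \<sigma> ` I_FFLV n rs))"
proof (intro conjI allI impI notI)
  fix \<sigma> assume \<sigma>: "\<sigma> permutes {1..n}"
  obtain g where g: "g \<in> I_FFLV n rs" "perm_poly \<sigma> g \<noteq> 0" "\<forall>u. 0 \<le> lookup (perm_poly \<sigma> g) u"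
    using perm_poly_I_FFLV_nonneg[OF assms permutes_inj[OF \<sigma>]] by blast
  show "perm_weight \<sigma> ` C_FFLV_rel_interior n rs \<inter> Trop_pos n (plucker_ideal n) = {}"
  proof (rule ccontr)
    assume "perm_weight \<sigma> ` C_FFLV_rel_interior n rs \<inter> Trop_pos n (plucker_ideal n) \<noteq> {}"
    then obtain w where w: "in_weight n w (plucker_ideal n) = I_FFLV n rs"
        "totally_positive (in_weight n (perm_weight \<sigma> w) (plucker_ideal n))"
      by (auto simp: C_FFLV_rel_interior_def cone_rel_interior_def Trop_pos_def)
    \<comment> \<open>\<open>g\<close> lies in the initial ideal at \<open>w\<close>, which is the
      FFLV ideal; \<sigma> moves it to a nonzero nonnegative element at the permuted weight.\<close>
    then have "perm_poly \<sigma> g \<in> in_weight n (perm_weight \<sigma> w) (plucker_ideal n)"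
      using perm_poly_in_weight[OF \<sigma>] g(1) by metis
    then show False using g w(2) unfolding totally_positive_def by blast
  qed
next
  assume "\<exists>\<sigma>. \<sigma> permutes {1..n} \<and> totally_positive (perm_poly \<sigma> ` I_FFLV n rs)"
  then obtain \<sigma> where \<sigma>: "\<sigma> permutes {1..n}" "totally_positive (perm_poly \<sigma> ` I_FFLV n rs)"
    by blast
  then show False
    using perm_poly_I_FFLV_nonneg[OF assms permutes_inj[OF \<sigma>(1)]]
    unfolding totally_positive_def by blast
qed

end
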